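(* Let $\tau>0$, $s\in\{1,\dots,m\}$, $0<\epsilon<1$, $0<\delta\le\sqrt2-1$. Suppose that $\psi_1,\dots,\psi_m$ are orthonormal functions in $L^2_\rho(\mathbb{X})$ and that there exists a constant $B\ge1$ such that $\|\psi_j\|_\infty\le B$ for all $j\in\{1,\dots,m\}$. Let $$L(s)=\log(2B^2s)\left[\log(2B^2s)\cdot\log(2m)+\log\left(2\epsilon^{-1}\log(2B^2s)\right)\right].$$ There exists a universal constant $C>0$ such that for all $n\ge C\cdot\delta^{-2}\cdot B^2\cdot s\cdot L(s)$ the following holds. Let $\{\mathbf{x}_t^{(i)}\}_{i=1}^n$ be $n$ data points sampled i.i.d. from $\rho$ and $\mathbf{y}_t^{(i)}=\mathbf{x}_{t+\tau}^{(i)}$. Suppose $K_m^\tau\in\mathbb{C}^{l\times m}$ satisfies $\Phi_n^\tau=K_m^\tau\Psi_n$. Let $(K_{mn}^\tau)^\#$ be the solution of the QCBP-EDMD problem $$\min_{K\in\mathbb{C}^{l\times m}}\|K\|_{F,1}\quad\text{subject to}\quad\|\Phi_n^\tau-K\Psi_n\|_F\le\sigma$$ with $\sigma=0$. Then, with probability greater than $1-\epsilon$, there exists a constant $C_1$ such that $$\bigl\|(K_{mn}^\tau)^\#-K_m^\tau\bigr\|_F^2\le C_1\sum_{i=1}^l\frac{\sigma_s(\mathbf{k}_{m,i})^2}{s},$$ where $\mathbf{k}_{m,i}\in\mathbb{C}^m$ is the $i$th column of $(K_m^\tau)^*$.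
   Context: Let $\mathbb{X}\subseteq\mathbb{R}^d$ be the state space of a dynamical system with states $\mathbf{x}_t$, and let $\rho$ be a probability measure on $\mathbb{X}$. Data are pairs $(\mathbf{x}_t^{(i)},\mathbf{y}_t^{(i)})$, $i=1,\dots,n$, where the $\mathbf{x}_t^{(i)}$ are i.i.d. with law $\rho$ and $\mathbf{y}_t^{(i)}=\mathbf{x}_{t+\tau}^{(i)}$ is the state reached from $\mathbf{x}_t^{(i)}$ after time $\tau$. Let $\vec\psi=(\psi_1,\dots,\psi_m)$ and $\vec\phi=(\phi_1,\dots,\phi_l)$ be dictionaries of possibly complex-valued functions in $L^2_\rho(\mathbb{X})$. Set $\Psi_n=(\psi_i(\mathbf{x}_t^{(j)}))_{i,j}\in\mathbb{C}^{m\times n}$ and $\Phi_n^\tau=(\phi_i(\mathbf{y}_t^{(j)}))_{i,j}\in\mathbb{C}^{l\times n}$. The Koopman operator is $\mathcal{K}^\tau[\varphi](\mathbf{x})=\mathbb{E}[\varphi(\mathbf{x}_{t+\tau})\mid\mathbf{x}_t=\mathbf{x}]$, and $K_m^\tau$ denotes the matrix representing its projection in $L^2_\rho(\mathbb{X})$ onto $\mathrm{span}\{\psi_1,\dots,\psi_m\}$: $\sum_{i=1}^m(K_m^\tau)_{ji}\psi_i$ is the projection of $\mathcal{K}^\tau[\phi_j]$. EDMD stands for Extended Dynamic Mode Decomposition and QCBP for Quadratically Constrained Basis Pursuit. $\|\cdot\|_F$ is the Frobenius norm, $\|A\|_{F,1}=\sum_{i,j}|A_{ij}|$ is the entrywise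 $\ell_1$-norm, and $A^*$ is the conjugate transpose. The $\ell_1$ best $s$-term approximation error of a vector $\mathbf{c}$ is $\sigma_s(\mathbf{c})=\min_{\|\mathbf{z}\|_0\le s}\|\mathbf{c}-\mathbf{z}\|_1$, where $\|\mathbf{z}\|_0$ is the number of nonzero entries of $\mathbf{z}$. The scalar $\sigma$ in the constraint is unrelated to $\sigma_s(\cdot)$. *)

theory Defs
  imports "Jordan_Normal_Form.Schur_Decomposition" "HOL-Probability.Probability"
begin

hide_const (open) Finite_Cartesian_Product.mat Finite_Cartesian_Product.vec
  Finite_Cartesian_Product.row Finite_Cartesian_Product.column

text \<open>
  Vectors of \<open>\<real>\<^sup>d\<close> are functions on \<open>{..<d}\<close> (extended by \<open>undefined\<close>), so that the dimension \<open>d\<close>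
  can be quantified inside a formula, below a universal constant. The product sigma-algebra
  is the Borel sigma-algebra of \<open>\<real>\<^sup>d\<close>.
\<close>

type_synonym state = "nat \<Rightarrow> real"

text \<open>
  A sample point \<open>\<omega>\<close> lists trajectories, with \<open>\<omega> i u\<close> the state of trajectory \<open>i\<close> at time \<open>u\<close>. Any
  process can be transported to this canonical sample space, whose type, unlike a type variable,
  does not stand above a universal constant.
\<close>

type_synonym trajectories = "nat \<Rightarrow> real \<Rightarrow> state"

definition state_space :: "nat \<Rightarrow> state set \<Rightarrow> state measure" where
  "state_space d X = restrict_space (Pi\<^sub>M {..<d} (\<lambda>_. borel)) X"

text \<open>
  The possibly stochastic dynamics is given by kernels: \<open>P \<tau> x\<close> is the law of \<open>x\<^bsub>t+\<tau>\<^esub>\<close> given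
  \<open>x\<^sub>t = x\<close> (a Dirac measure for a deterministic flow).
\<close>

definition koopman ::
    "(real \<Rightarrow> state \<Rightarrow> state measure) \<Rightarrow> real \<Rightarrow> (state \<Rightarrow> complex) \<Rightarrow> state \<Rightarrow> complex" where
  "koopman P \<tau> \<phi> x = (\<integral>y. \<phi> y \<partial>P \<tau> x)"

text \<open>
  \<open>Z u\<close> is the random state at time \<open>u\<close>. The conditional law of \<open>Z (t + \<tau>)\<close> given \<open>Z t\<close> is
  \<open>P \<tau> (Z t)\<close>; this is expressed through the joint law of \<open>(Z t, Z (t + \<tau>))\<close>.
\<close>

definition transition_law ::
    "state measure \<Rightarrow> (real \<Rightarrow> state \<Rightarrow> state measure) \<Rightarrow> 'w measure \<Rightarrow> (real \<Rightarrow> 'w \<Rightarrow> state)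
      \<Rightarrow> real \<Rightarrow> real \<Rightarrow> bool" where
  "transition_law S P M Z t \<tau> \<longleftrightarrow>
     Z t \<in> measurable M S \<and> Z (t + \<tau>) \<in> measurable M S \<and>
     distr M (S \<Otimes>\<^sub>M S) (\<lambda>\<omega>. (Z t \<omega>, Z (t + \<tau>) \<omega>)) =
       distr M S (Z t) \<bind> (\<lambda>x. distr (P \<tau> x) (S \<Otimes>\<^sub>M S) (Pair x))"

definition iid_sample ::
    "'w measure \<Rightarrow> 'a measure \<Rightarrow> nat \<Rightarrow> (nat \<Rightarrow> 'w \<Rightarrow> 'a) \<Rightarrow> bool" where
  "iid_sample M \<rho> n x \<longleftrightarrow>
     prob_space.indep_vars M (\<lambda>_. \<rho>) x {..<n} \<and> (\<forall>i<n. distr M \<rho> (x i) = \<rho>)"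

definition in_L2 :: "'a measure \<Rightarrow> ('a \<Rightarrow> complex) \<Rightarrow> bool" where
  "in_L2 \<rho> f \<longleftrightarrow> f \<in> borel_measurable \<rho> \<and> integrable \<rho> (\<lambda>x. (cmod (f x))\<^sup>2)"

definition L2_inner :: "'a measure \<Rightarrow> ('a \<Rightarrow> complex) \<Rightarrow> ('a \<Rightarrow> complex) \<Rightarrow> complex" where
  "L2_inner \<rho> f g = (\<integral>x. f x * cnj (g x) \<partial>\<rho>)"

definition L2_orthonormal :: "'a measure \<Rightarrow> nat \<Rightarrow> (nat \<Rightarrow> 'a \<Rightarrow> complex) \<Rightarrow> bool" where
  "L2_orthonormal \<rho> m \<psi> \<longleftrightarrow>
     (\<forall>j<m. in_L2 \<rho> (\<psi> j)) \<and>
     (\<forall>i<m. \<forall>j<m. L2_inner \<rho> (\<psi> i) (\<psi> j) = (if i = j then 1 else 0))"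

definition dictionary_span :: "nat \<Rightarrow> (nat \<Rightarrow> 'a \<Rightarrow> complex) \<Rightarrow> ('a \<Rightarrow> complex) set" where
  "dictionary_span m \<psi> = {\<lambda>x. \<Sum>i<m. c i * \<psi> i x | c. True}"

definition L2_projection ::
    "'a measure \<Rightarrow> ('a \<Rightarrow> complex) set \<Rightarrow> ('a \<Rightarrow> complex) \<Rightarrow> ('a \<Rightarrow> complex) \<Rightarrow> bool" where
  "L2_projection \<rho> V g p \<longleftrightarrow> p \<in> V \<and> (\<forall>v\<in>V. L2_inner \<rho> (\<lambda>x. g x - p x) v = 0)"

text \<open>
  The first two conditions on \<open>\<phi> j\<close> say that its image under the Koopman operator is a
  well-defined element of L2, which is not automatic when \<open>\<rho>\<close> is not invariant.
\<close>

definition koopman_matrix ::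
    "state measure \<Rightarrow> (real \<Rightarrow> state \<Rightarrow> state measure) \<Rightarrow> real \<Rightarrow> nat \<Rightarrow> (nat \<Rightarrow> state \<Rightarrow> complex)
      \<Rightarrow> nat \<Rightarrow> (nat \<Rightarrow> state \<Rightarrow> complex) \<Rightarrow> complex mat \<Rightarrow> bool" where
  "koopman_matrix \<rho> P \<tau> m \<psi> l \<phi> K \<longleftrightarrow>
     K \<in> carrier_mat l m \<and>
     (\<forall>j<l. (AE x in \<rho>. integrable (P \<tau> x) (\<phi> j)) \<and> in_L2 \<rho> (koopman P \<tau> (\<phi> j)) \<and>
        L2_projection \<rho> (dictionary_span m \<psi>) (koopman P \<tau> (\<phi> j))
          (\<lambda>x. \<Sum>i<m. K $$ (j, i) * \<psi> i x))"

definition data_mat :: "nat \<Rightarrow> nat \<Rightarrow> (nat \<Rightarrow> 'a \<Rightarrow> complex) \<Rightarrow> (nat \<Rightarrow> 'a) \<Rightarrow> complex mat" where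
  "data_mat m n \<psi> x = Matrix.mat m n (\<lambda>(i, j). \<psi> i (x j))"

definition frobenius_norm :: "complex mat \<Rightarrow> real" where
  "frobenius_norm A = sqrt (\<Sum>i<dim_row A. \<Sum>j<dim_col A. (cmod (A $$ (i, j)))\<^sup>2)"

definition entrywise_l1_norm :: "complex mat \<Rightarrow> real" where
  "entrywise_l1_norm A = (\<Sum>i<dim_row A. \<Sum>j<dim_col A. cmod (A $$ (i, j)))"

definition vec_l1_norm :: "complex Matrix.vec \<Rightarrow> real" where
  "vec_l1_norm c = (\<Sum>i<dim_vec c. cmod (vec_index c i))"

definition vec_l0 :: "complex Matrix.vec \<Rightarrow> nat" where
  "vec_l0 c = card {i. i < dim_vec c \<and> vec_index c i \<noteq> 0}"

text \<open>The infimum is attained, by keeping \<open>s\<close> entries of \<open>c\<close> of largest modulus.\<close>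

definition best_term_error :: "nat \<Rightarrow> complex Matrix.vec \<Rightarrow> real" where
  "best_term_error s c =
     (INF z \<in> {z \<in> carrier_vec (dim_vec c). vec_l0 z \<le> s}. vec_l1_norm (c - z))"

definition qcbp_edmd_solution :: "complex mat \<Rightarrow> complex mat \<Rightarrow> real \<Rightarrow> complex mat \<Rightarrow> bool" where
  "qcbp_edmd_solution \<Phi> \<Psi> \<sigma> K \<longleftrightarrow>
     is_arg_min entrywise_l1_norm
       (\<lambda>K. K \<in> carrier_mat (dim_row \<Phi>) (dim_row \<Psi>) \<and> frobenius_norm (\<Phi> - K * \<Psi>) \<le> \<sigma>) K"

definition log_factor :: "real \<Rightarrow> nat \<Rightarrow> real \<Rightarrow> nat \<Rightarrow> real" where
  "log_factor B m \<epsilon> s =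
     ln (2 * B\<^sup>2 * real s) *
       (ln (2 * B\<^sup>2 * real s) * ln (2 * real m) + ln (2 * inverse \<epsilon> * ln (2 * B\<^sup>2 * real s)))"

end

theory Submission
  imports Defs
begin

text \<open>
  Exact \<open>\<ell>\<^sub>1\<close> minimisation decouples into the rows of \<open>K\<close>, and recovery of a row only needs that the
  kernel of the data matrix contains no nonzero \<open>v\<close> in the cone
  \<open>\<parallel>v\<parallel>\<^sub>1 \<le> 4 \<surd>s \<parallel>v\<parallel>\<^sub>2\<close>. This one-sided property is proved directly, without the restricted isometry
  property. If \<open>v\<close> is a unit vector in the cone, then
  \<open>f = \<bar>\<Sum>k. v k * \<psi> k\<bar>\<close> has second moment 1 and \<open>f\<^sup>2 \<le> 16 B\<^sup>2 s\<close>, so on one of \<open>N = O(log (B\<^sup>2 s))\<close> dyadic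
  levels \<open>f\<^sup>2 > 2 ^ i / 2\<close> has probability at least \<open>1 / (N 2 ^ i)\<close>. By Maurey's empirical method \<open>v\<close> is
  approximated, up to half the level and outside a small fraction of both \<open>\<rho>\<close> and the sample, by an
  average of \<open>t\<^sub>i = O(B\<^sup>2 s log (B\<^sup>2 s) / 2 ^ i)\<close> multiples of unit vectors. If \<open>v\<close> lies in the kernel, this
  average is large on far too few sample points. A Chernoff bound makes that unlikely for each
  of the \<open>(4m) ^ t\<^sub>i\<close> averages, and the factors \<open>2 ^ i\<close> cancel in the union bound.
\<close>

subsection \<open>Lower tail of a binomial count\<close>

text \<open>Chernoff's method with parameter 1: Markov's inequality for the product of the
  independent variables \<open>exp (- indicator A (X j))\<close>. Each has mean at most
  \<open>exp (- (q / 2))\<close>, and the exponents combine to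
  \<open>n * q / 3 - n * q / 2 = - (n * q / 6)\<close>.\<close>

lemma (in prob_space) prob_count_le_third:
  assumes indep: "indep_vars (\<lambda>_. S) X {..<n}"
    and A: "A \<in> sets S"
    and q: "\<And>j. j < n \<Longrightarrow> q \<le> prob (X j -` A \<inter> space M)"
  shows "{\<omega> \<in> space M. real (card {j. j < n \<and> X j \<omega> \<in> A}) \<le> real n * q / 3} \<in> events"
    and "prob {\<omega> \<in> space M. real (card {j. j < n \<and> X j \<omega> \<in> A}) \<le> real n * q / 3}
      \<le> exp (- (real n * q / 6))"
proof -
  have X[measurable]: "j < n \<Longrightarrow> X j \<in> measurable M S" for j
    using indep by (auto simp: indep_vars_def)
  note A[measurable]
  define Y where "Y j \<omega> = exp (- indicator A (X j \<omega>) :: real)" for j \<omega>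
  have count: "(\<Sum>j<n. indicator A (X j \<omega>)) = real (card {j. j < n \<and> X j \<omega> \<in> A})" for \<omega>
  proof -
    have "(\<Sum>j<n. indicator A (X j \<omega>)) = real (card ({..<n} \<inter> {j. X j \<omega> \<in> A}))"
      by (simp add: indicator_def of_bool_def sum.If_cases)
    also have "{..<n} \<inter> {j. X j \<omega> \<in> A} = {j. j < n \<and> X j \<omega> \<in> A}" by auto
    finally show ?thesis .
  qed
  have set_eq: "{\<omega> \<in> space M. real (card {j. j < n \<and> X j \<omega> \<in> A}) \<le> real n * q / 3}
      = {\<omega> \<in> space M. (\<Sum>j<n. indicator A (X j \<omega>)) \<le> real n * q / 3}"
    by (simp only: count)
  show ev: "{\<omega> \<in> space M. real (card {j. j < n \<and> X j \<omega> \<in> A}) \<le> real n * q / 3} \<in> events"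
    unfolding set_eq by measurable
  have Y_prod: "(\<Prod>j<n. Y j \<omega>) = exp (- real (card {j. j < n \<and> X j \<omega> \<in> A}))" for \<omega>
    by (simp add: Y_def flip: count exp_sum sum_negf)
  have Y_nonneg: "0 \<le> Y j \<omega>" for j \<omega> by (simp add: Y_def)
  have indepY: "indep_vars (\<lambda>_. borel) Y {..<n}"
    unfolding Y_def by (rule indep_vars_compose2[OF indep]) measurable
  have intY: "integrable M (Y j)" if "j < n" for j
    using that unfolding Y_def by (intro integrable_const_bound[where B = 1]) auto
  have EY: "0 \<le> (\<integral>\<omega>. Y j \<omega> \<partial>M)" "(\<integral>\<omega>. Y j \<omega> \<partial>M) \<le> exp (- (q / 2))" if j: "j < n" for j
  proof -
    show "0 \<le> (\<integral>\<omega>. Y j \<omega> \<partial>M)" by (simp add: Y_def)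
    have "exp 1 \<ge> (2::real)" using exp_ge_add_one_self[of "1::real"] by simp
    then have e: "exp (-1) \<le> (1/2::real)" by (simp add: exp_minus field_simps)
    have ind: "integrable M (indicat_real (X j -` A \<inter> space M))"
      using j by (intro integrable_const_bound[where B = 1]) auto
    then have int2: "integrable M (\<lambda>\<omega>. indicat_real (X j -` A \<inter> space M) \<omega> / 2)"
      by (rule integrable_divide_zero)
    then have int: "integrable M (\<lambda>\<omega>. 1 - indicat_real (X j -` A \<inter> space M) \<omega> / 2)"
      by (intro Bochner_Integration.integrable_diff integrable_const)
    \<comment> \<open>Since \<open>exp (-1) \<le> 1 / 2\<close>, the linear bound
      \<open>exp (- x) \<le> 1 - x / 2\<close> holds at both values 0 and 1 of the
      indicator.\<close>
    have "(\<integral>\<omega>. Y j \<omega> \<partial>M) \<le> (\<integral>\<omega>. 1 - indicator (X j -` A \<inter> space M) \<omega> / 2 \<partial>M)"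
      using j e by (intro integral_mono intY int) (auto simp: Y_def indicator_def)
    also have "\<dots> = 1 - prob (X j -` A \<inter> space M) / 2"
      using j ind int2 by (subst Bochner_Integration.integral_diff) (auto simp: prob_space)
    also have "\<dots> \<le> 1 - q / 2" using q[OF j] by simp
    also have "\<dots> \<le> exp (- (q / 2))" using exp_ge_add_one_self[of "- (q/2)"] by simp
    finally show "(\<integral>\<omega>. Y j \<omega> \<partial>M) \<le> exp (- (q / 2))" .
  qed
  have "prob {\<omega> \<in> space M. real (card {j. j < n \<and> X j \<omega> \<in> A}) \<le> real n * q / 3}
      = prob {\<omega> \<in> space M. exp (- (real n * q / 3)) \<le> (\<Prod>j<n. Y j \<omega>)}"
    by (simp add: Y_prod)
  also have "\<dots> \<le> (\<integral>\<omega>. (\<Prod>j<n. Y j \<omega>) \<partial>M) / exp (- (real n * q / 3))"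
    by (rule integral_Markov_inequality_measure[where A = "{}"])
      (auto intro!: indep_vars_integrable indepY intY AE_I2 simp: prod_nonneg Y_nonneg)
  also have "(\<integral>\<omega>. (\<Prod>j<n. Y j \<omega>) \<partial>M) = (\<Prod>j<n. \<integral>\<omega>. Y j \<omega> \<partial>M)"
    by (rule indep_vars_lebesgue_integral) (auto intro!: indepY intY)
  also have "\<dots> \<le> (\<Prod>j<n. exp (- (q / 2)))"
    by (intro prod_mono) (auto intro!: EY)
  also have "\<dots> = exp (- (real n * q / 2))"
    by (simp flip: exp_of_nat_mult)
  finally show "prob {\<omega> \<in> space M. real (card {j. j < n \<and> X j \<omega> \<in> A}) \<le> real n * q / 3}
      \<le> exp (- (real n * q / 6))"
    by (simp add: divide_right_mono mult.commute flip: exp_diff)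
qed

subsection \<open>Maurey's empirical method\<close>

text \<open>Hoeffding's inequality for \<open>t\<close> independent draws from \<open>p\<close>:
  each summand ranges over an interval of length \<open>2 * R\<close>, hence the exponent
  \<open>2 * (t * r)\<^sup>2 / (t * (2 * R)\<^sup>2)\<close>.\<close>

lemma Pi_pmf_average_real_tail:
  fixes f :: "'i \<Rightarrow> real" and p :: "'i pmf"
  assumes f: "\<And>i. i \<in> set_pmf p \<Longrightarrow> \<bar>f i\<bar> \<le> R" and R: "R > 0" and "t > 0" "r \<ge> 0"
  shows "measure_pmf.prob (Pi_pmf {..<t} d (\<lambda>_. p))
      {g. \<bar>(\<Sum>k<t. f (g k)) / real t - measure_pmf.expectation p f\<bar> \<ge> r}
    \<le> 2 * exp (- (real t * r\<^sup>2 / (2 * R\<^sup>2)))"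
proof -
  let ?M = "Pi_pmf {..<t} d (\<lambda>_. p)"
  have comp: "map_pmf (\<lambda>g. g k) ?M = p" if "k < t" for k
    using that by (subst Pi_pmf_component) auto
  interpret Hoeffding_ineq "measure_pmf ?M" "{..<t}" "\<lambda>k g. f (g k)" "\<lambda>_. - R" "\<lambda>_. R"
    "real t * measure_pmf.expectation p f"
  proof (unfold_locales, goal_cases)
    case 1 show ?case by simp
  next
    case 2 show ?case
      by (rule prob_space.indep_vars_compose2[OF prob_space_measure_pmf indep_vars_Pi_pmf]) auto
  next
    case (3 k)
    have "AE i in measure_pmf p. f i \<in> {-R..R}"
      using f by (auto simp: AE_measure_pmf_iff abs_le_iff minus_le_iff)
    then show ?case using 3
      by (subst (asm) comp[symmetric, of k]) (auto simp: AE_measure_pmf_iff)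
  next
    case 4
    have "measure_pmf.expectation ?M (\<lambda>g. f (g k)) = measure_pmf.expectation p f" if "k < t" for k
      using that by (subst (2) comp[symmetric, of k]) auto
    then show "PROP ?case" by simp
  qed
  have "measure_pmf.prob ?M {g. \<bar>(\<Sum>k<t. f (g k)) / real t - measure_pmf.expectation p f\<bar> \<ge> r}
      = measure_pmf.prob ?M {g \<in> space ?M.
          \<bar>(\<Sum>k<t. f (g k)) - real t * measure_pmf.expectation p f\<bar> \<ge> real t * r}"
  proof (intro arg_cong[where f = "measure_pmf.prob ?M"] Collect_cong)
    fix g
    have "(\<Sum>k<t. f (g k)) / real t - measure_pmf.expectation p f
      = ((\<Sum>k<t. f (g k)) - real t * measure_pmf.expectation p f) / real t"
      using \<open>t > 0\<close> by (simp add: field_simps)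
    then show "r \<le> \<bar>(\<Sum>k<t. f (g k)) / real t - measure_pmf.expectation p f\<bar> \<longleftrightarrow>
      g \<in> space ?M \<and> real t * r \<le> \<bar>(\<Sum>k<t. f (g k)) - real t * measure_pmf.expectation p f\<bar>"
      using \<open>t > 0\<close> by (simp add: field_simps)
  qed
  also have "\<dots> \<le> 2 * exp (-2 * (real t * r)\<^sup>2 / (\<Sum>k<t. (R - - R)\<^sup>2))"
    using assms by (intro Hoeffding_ineq_abs_ge) auto
  also have "-2 * (real t * r)\<^sup>2 / (\<Sum>k<t. (R - - R)\<^sup>2) = - (real t * r\<^sup>2 / (2 * R\<^sup>2))"
    using assms by (simp add: field_simps power2_eq_square)
  finally show ?thesis .
qed

text \<open>A complex deviation above \<open>r\<close> forces a deviation of at least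
  \<open>r / 2\<close> in the real or the imaginary part. Two real tails at \<open>r / 2\<close>
  give the factor 4 and the denominator 8.\<close>

lemma Pi_pmf_average_complex_tail:
  fixes f :: "'i \<Rightarrow> complex" and p :: "'i pmf"
  assumes fin: "finite (set_pmf p)"
    and f: "\<And>i. i \<in> set_pmf p \<Longrightarrow> cmod (f i) \<le> R" and R: "R > 0" and "t > 0" "r \<ge> 0"
  shows "measure_pmf.prob (Pi_pmf {..<t} d (\<lambda>_. p))
      {g. r < cmod ((\<Sum>k<t. f (g k)) / of_nat t - measure_pmf.expectation p f)}
    \<le> 4 * exp (- (real t * r\<^sup>2 / (8 * R\<^sup>2)))"
proof -
  let ?M = "Pi_pmf {..<t} d (\<lambda>_. p)"
  let ?A = "\<lambda>h. {g. r / 2 \<le> \<bar>(\<Sum>k<t. h (f (g k))) / real t - measure_pmf.expectation p (\<lambda>i. h (f i))\<bar>}"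
  have int: "integrable p f" using fin by (rule integrable_measure_pmf_finite)
  have sub: "{g. r < cmod ((\<Sum>k<t. f (g k)) / of_nat t - measure_pmf.expectation p f)} \<subseteq> ?A Re \<union> ?A Im"
  proof clarify
    fix g
    let ?z = "(\<Sum>k<t. f (g k)) / of_nat t - measure_pmf.expectation p f"
    assume 1: "r < cmod ?z" and 2: "\<not> r / 2 \<le> \<bar>(\<Sum>k<t. Im (f (g k))) / real t - measure_pmf.expectation p (\<lambda>i. Im (f i))\<bar>"
    have "cmod ?z \<le> \<bar>Re ?z\<bar> + \<bar>Im ?z\<bar>" by (rule cmod_le)
    moreover have "Re ?z = (\<Sum>k<t. Re (f (g k))) / real t - measure_pmf.expectation p (\<lambda>i. Re (f i))"
      using int by (simp add: Re_divide_of_nat)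
    moreover have "Im ?z = (\<Sum>k<t. Im (f (g k))) / real t - measure_pmf.expectation p (\<lambda>i. Im (f i))"
      using int by (simp add: Im_divide_of_nat)
    ultimately show "r / 2 \<le> \<bar>(\<Sum>k<t. Re (f (g k))) / real t - measure_pmf.expectation p (\<lambda>i. Re (f i))\<bar>"
      using 1 2 by linarith
  qed
  have half: "measure_pmf.prob ?M (?A h) \<le> 2 * exp (- (real t * r\<^sup>2 / (8 * R\<^sup>2)))"
    if h: "\<And>z. \<bar>h z\<bar> \<le> cmod z" for h
  proof -
    have "measure_pmf.prob ?M (?A h) \<le> 2 * exp (- (real t * (r / 2)\<^sup>2 / (2 * R\<^sup>2)))"
      using assms by (intro Pi_pmf_average_real_tail order_trans[OF h f]) auto
    also have "real t * (r / 2)\<^sup>2 / (2 * R\<^sup>2) = real t * r\<^sup>2 / (8 * R\<^sup>2)"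
      by (simp add: power_divide)
    finally show ?thesis .
  qed
  have "measure_pmf.prob ?M {g. r < cmod ((\<Sum>k<t. f (g k)) / of_nat t - measure_pmf.expectation p f)}
      \<le> measure_pmf.prob ?M (?A Re \<union> ?A Im)"
    by (rule measure_pmf.finite_measure_mono[OF sub]) simp
  also have "\<dots> \<le> measure_pmf.prob ?M (?A Re) + measure_pmf.prob ?M (?A Im)"
    by (rule measure_Un_le) auto
  also have "\<dots> \<le> 2 * exp (- (real t * r\<^sup>2 / (8 * R\<^sup>2))) + 2 * exp (- (real t * r\<^sup>2 / (8 * R\<^sup>2)))"
    by (intro add_mono half abs_Re_le_cmod abs_Im_le_cmod)
  finally show ?thesis by simp
qed

text \<open>Exchanging the integral over \<open>y\<close> with the average over \<open>g\<close>, a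
  finite sum because \<open>p\<close> has finite support, leaves the tail of
  \<open>Pi_pmf_average_complex_tail\<close> at each fixed \<open>y\<close>. The space
  \<open>N\<close> is general because it will be both \<open>\<rho>\<close> and the uniform
  distribution on the sample indices.\<close>

lemma expectation_Pi_pmf_average_tail:
  fixes F :: "'i \<Rightarrow> 'a \<Rightarrow> complex" and p :: "'i pmf"
  assumes N: "prob_space N" and fin: "finite (set_pmf p)"
    and [measurable]: "\<And>i. i \<in> set_pmf p \<Longrightarrow> F i \<in> borel_measurable N"
    and F: "AE y in N. \<forall>i\<in>set_pmf p. cmod (F i y) \<le> R" and "R > 0" "t > 0" "r \<ge> 0"
  shows "measure_pmf.expectation (Pi_pmf {..<t} d (\<lambda>_. p))
      (\<lambda>g. measure N {y \<in> space N.
        r < cmod ((\<Sum>k<t. F (g k) y) / of_nat t - measure_pmf.expectation p (\<lambda>i. F i y))})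
    \<le> 4 * exp (- (real t * r\<^sup>2 / (8 * R\<^sup>2)))"
proof -
  interpret N: prob_space N by fact
  let ?M = "Pi_pmf {..<t} d (\<lambda>_. p)"
  let ?G = "set_pmf ?M"
  define A where "A g = {y \<in> space N.
    r < cmod ((\<Sum>k<t. F (g k) y) / of_nat t - measure_pmf.expectation p (\<lambda>i. F i y))}" for g
  have finG: "finite ?G"
    by (subst set_Pi_pmf) (auto intro!: finite_PiE_dflt fin)
  have E: "measure_pmf.expectation p (\<lambda>i. F i y) = (\<Sum>i\<in>set_pmf p. pmf p i *\<^sub>R F i y)" for y
    by (rule integral_measure_pmf[OF fin])
  have G: "g k \<in> set_pmf p" if "g \<in> ?G" "k < t" for g k
    using that by (auto simp: set_Pi_pmf PiE_dflt_def)
  have A[measurable]: "A g \<in> sets N" if "g \<in> ?G" for g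
  proof -
    have [measurable]: "F (g k) \<in> borel_measurable N" if "k \<in> {..<t}" for k
      using G[OF \<open>g \<in> ?G\<close>] that by auto
    show ?thesis unfolding A_def E by measurable
  qed
  have intA: "integrable N (\<lambda>y. pmf ?M g * indicator (A g) y)" if "g \<in> ?G" for g
    using that by (intro integrable_mult_right N.integrable_const_bound[where B = 1]) auto
  have "measure_pmf.expectation ?M (\<lambda>g. measure N (A g)) = (\<Sum>g\<in>?G. pmf ?M g * measure N (A g))"
    by (subst integral_measure_pmf[OF finG]) auto
  also have "\<dots> = (\<Sum>g\<in>?G. \<integral>y. pmf ?M g * indicator (A g) y \<partial>N)"
    by (intro sum.cong) (auto simp: A)
  also have "\<dots> = (\<integral>y. (\<Sum>g\<in>?G. pmf ?M g * indicator (A g) y) \<partial>N)"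
    by (subst Bochner_Integration.integral_sum) (rule intA, simp_all)
  also have "\<dots> \<le> (\<integral>y. 4 * exp (- (real t * r\<^sup>2 / (8 * R\<^sup>2))) \<partial>N)"
  proof (rule integral_mono_AE)
    show "AE y in N. (\<Sum>g\<in>?G. pmf ?M g * indicator (A g) y) \<le> 4 * exp (- (real t * r\<^sup>2 / (8 * R\<^sup>2)))"
      using F
    proof (eventually_elim)
      case (elim y)
      have "(\<Sum>g\<in>?G. pmf ?M g * indicator (A g) y) = measure_pmf.expectation ?M (indicator {g. y \<in> A g})"
        by (subst integral_measure_pmf[OF finG]) (auto simp: indicator_def)
      also have "\<dots> = measure_pmf.prob ?M {g. y \<in> A g}" by simp
      also have "\<dots> \<le> measure_pmf.prob ?M {g.
        r < cmod ((\<Sum>k<t. F (g k) y) / of_nat t - measure_pmf.expectation p (\<lambda>i. F i y))}"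
        by (intro measure_pmf.finite_measure_mono) (auto simp: A_def)
      also have "\<dots> \<le> 4 * exp (- (real t * r\<^sup>2 / (8 * R\<^sup>2)))"
        using elim assms by (intro Pi_pmf_average_complex_tail) auto
      finally show ?case .
    qed
  qed ((rule Bochner_Integration.integrable_sum intA N.integrable_const | assumption)+)
  also have "\<dots> = 4 * exp (- (real t * r\<^sup>2 / (8 * R\<^sup>2)))" by (simp add: N.prob_space)
  finally show ?thesis unfolding A_def .
qed

text \<open>Maurey's method needs \<open>v\<close> as the mean of a random unit vector times
  \<open>R * u\<close>, with \<open>u\<close> a fourth root of unity. Radius \<open>R / 2\<close>
  suffices because real and imaginary part are each at most the modulus.\<close>

lemma expectation_l1_vertices:
  fixes v :: "nat \<Rightarrow> complex"
  assumes "m > 0" and R: "R > 0" and v: "(\<Sum>k<m. cmod (v k)) \<le> R / 2"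
  obtains p :: "(nat \<times> complex) pmf" where "set_pmf p \<subseteq> {..<m} \<times> {1, -1, \<i>, -\<i>}"
    "\<And>f. measure_pmf.expectation p (\<lambda>i. of_real R * snd i * f (fst i)) = (\<Sum>k<m. v k * f k)"
proof
  let ?U = "{1, -1, \<i>, -\<i>} :: complex set"
  have U: "(\<Sum>u\<in>?U. h u) = h 1 + h (-1) + h \<i> + h (-\<i>)" for h :: "complex \<Rightarrow> 'b :: comm_monoid_add"
    by (simp add: complex_eq_iff add_ac)
  let ?I = "{..<m} \<times> ?U"
  \<comment> \<open>Coordinate \<open>k\<close> receives total weight \<open>2 * \<beta> k\<close>.
    Spreading the slack of \<open>v\<close> evenly makes these weights add up to 1, and
    \<open>\<beta> k \<ge> cmod (v k) / R\<close> makes \<open>w\<close> nonnegative.\<close>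
  define \<beta> where "\<beta> k = cmod (v k) / R + (1/2 - (\<Sum>k<m. cmod (v k)) / R) / m" for k
  \<comment> \<open>For opposite units \<open>u\<close> and \<open>-u\<close> the weights have sum
    \<open>\<beta> k\<close>, and their difference is the component of \<open>v k / R\<close> along
    \<open>u\<close>, so the mean gets the right real and imaginary parts.\<close>
  define w where "w i = (if i \<in> ?I then (\<beta> (fst i) + Re (cnj (snd i) * v (fst i)) / R) / 2 else 0)" for i
  have "(\<Sum>k<m. cmod (v k)) / R \<le> 1 / 2" using v R by (simp add: field_simps)
  then have \<beta>: "cmod (v k) / R \<le> \<beta> k" for k
    by (simp add: \<beta>_def)
  have w: "0 \<le> w i" for i
  proof -
    have "\<bar>Re (cnj (snd i) * v (fst i))\<bar> \<le> cmod (v (fst i))" if "i \<in> ?I"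
      using that abs_Re_le_cmod[of "cnj (snd i) * v (fst i)"] by (auto simp: norm_mult)
    then have "- Re (cnj (snd i) * v (fst i)) / R \<le> cmod (v (fst i)) / R" if "i \<in> ?I"
      using that R by (intro divide_right_mono) fastforce+
    then show ?thesis using \<beta>[of "fst i"] by (auto simp: w_def)
  qed
  have sumU: "(\<Sum>u\<in>?U. w (k, u)) = 2 * \<beta> k" if "k < m" for k
    using that by (simp only: U) (simp add: w_def field_simps)
  have "(\<Sum>i\<in>?I. w i) = (\<Sum>k<m. 2 * \<beta> k)"
    unfolding sum.cartesian_product' by (intro sum.cong refl sumU) simp
  also have "\<dots> = 1"
    using \<open>m > 0\<close> by (simp add: \<beta>_def sum.distrib flip: sum_distrib_left sum_divide_distrib)
  finally have w1: "(\<Sum>i\<in>?I. w i) = 1" .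
  have "(\<integral>\<^sup>+i. ennreal (w i) \<partial>count_space UNIV) = (\<Sum>i\<in>?I. ennreal (w i))"
    by (rule nn_integral_count_space') (auto simp: w_def)
  also have "\<dots> = 1" using w w1 by (simp add: sum_ennreal)
  finally have w_pmf: "pmf (embed_pmf w) i = w i" "set_pmf (embed_pmf w) = {i. w i \<noteq> 0}" for i
    using w by (auto intro!: pmf_embed_pmf set_embed_pmf)
  show sub: "set_pmf (embed_pmf w) \<subseteq> ?I"
    by (auto simp: w_pmf w_def split: if_splits)
  fix f :: "nat \<Rightarrow> complex"
  have "measure_pmf.expectation (embed_pmf w) (\<lambda>i. of_real R * snd i * f (fst i))
      = (\<Sum>i\<in>?I. of_real (w i) * (of_real R * snd i * f (fst i)))"
    using sub by (subst integral_measure_pmf[of ?I]) (auto simp: w_pmf scaleR_conv_of_real)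
  also have "\<dots> = (\<Sum>k<m. \<Sum>u\<in>?U. of_real (w (k, u)) * (of_real R * u * f k))"
    by (simp only: sum.cartesian_product' fst_conv snd_conv)
  also have "\<dots> = (\<Sum>k<m. v k * f k)"
  proof (intro sum.cong refl)
    fix k assume k: "k \<in> {..<m}"
    have "(\<Sum>u\<in>?U. of_real (w (k, u)) * (of_real R * u * f k))
      = of_real R * f k * (of_real (w (k, 1) - w (k, -1)) + \<i> * of_real (w (k, \<i>) - w (k, -\<i>)))"
      by (simp only: U) (simp add: algebra_simps)
    also have "of_real (w (k, 1) - w (k, -1)) + \<i> * of_real (w (k, \<i>) - w (k, -\<i>)) = v k / of_real R"
      using k R by (simp add: w_def complex_eq_iff field_simps)
    finally show "(\<Sum>u\<in>?U. of_real (w (k, u)) * (of_real R * u * f k)) = v k * f k"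
      using R by simp
  qed
  finally show "measure_pmf.expectation (embed_pmf w) (\<lambda>i. of_real R * snd i * f (fst i))
      = (\<Sum>k<m. v k * f k)" .
qed

subsection \<open>Dyadic levels\<close>

text \<open>The increments are geometric: \<open>1 / 2\<close> plus \<open>2 ^ i / 2\<close> over
  all \<open>i < k\<close> is \<open>2 ^ k / 2\<close>. The right side is thus the least threshold
  \<open>2 ^ k / 2\<close> that is at least \<open>x\<close>.\<close>

lemma le_dyadic_sum:
  fixes x :: real
  assumes "x \<le> 2 ^ N / 2"
  shows "x \<le> 1/2 + (\<Sum>i<N. 2 ^ i / 2 * of_bool (2 ^ i / 2 < x))"
  using assms
proof (induction N)
  case (Suc N)
  show ?case
  proof (cases "x \<le> 2 ^ N / 2")
    case True
    then show ?thesis using Suc.IH by simp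
  next
    case False
    have "2 ^ i / 2 < x" if "i < Suc N" for i
    proof -
      have "(2::real) ^ i \<le> 2 ^ N" using that by (intro power_increasing) auto
      then show ?thesis using False by linarith
    qed
    then have "(\<Sum>i<Suc N. 2 ^ i / 2 * of_bool (2 ^ i / 2 < x)) = (\<Sum>i<Suc N. 2 ^ i / 2 :: real)"
      by (intro sum.cong) auto
    also have "\<dots> = (2 ^ Suc N - 1) / 2"
      by (induction N) (auto simp: field_simps)
    finally show ?thesis using Suc.prems by (simp add: field_simps)
  qed
qed simp

text \<open>Integrate \<open>le_dyadic_sum\<close>. If every level had smaller probability, each
  would contribute less than \<open>1 / (2 * N)\<close>, all together less than
  \<open>1 / 2\<close>, and the mean of \<open>h\<close> would be below 1.\<close>

lemma (in prob_space) exists_dyadic_level: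
  fixes h :: "'a \<Rightarrow> real"
  assumes int: "integrable M h" and le: "AE \<omega> in M. h \<omega> \<le> 2 ^ N / 2" and h1: "expectation h \<ge> 1"
  shows "\<exists>i<N. 1 / (real N * 2 ^ i) \<le> prob {\<omega> \<in> space M. 2 ^ i / 2 < h \<omega>}"
proof (rule ccontr)
  define A where "A i = {\<omega> \<in> space M. 2 ^ i / 2 < h \<omega>}" for i
  have [measurable]: "h \<in> borel_measurable M" using int by simp
  have A: "A i \<in> events" for i unfolding A_def by measurable
  have intA: "integrable M (\<lambda>\<omega>. 2 ^ i / 2 * indicat_real (A i) \<omega>)" for i
    using A by (intro integrable_mult_right integrable_const_bound[where B = 1]) auto
  assume "\<not> ?thesis"
  then have small: "prob (A i) < 1 / (real N * 2 ^ i)" if "i < N" for i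
    using that by (force simp: A_def not_le)
  have "expectation h \<le> expectation (\<lambda>\<omega>. 1/2 + (\<Sum>i<N. 2 ^ i / 2 * indicat_real (A i) \<omega>))"
  proof (rule integral_mono_AE[OF int])
    show "AE \<omega> in M. h \<omega> \<le> 1/2 + (\<Sum>i<N. 2 ^ i / 2 * indicat_real (A i) \<omega>)"
      using le AE_space
    proof eventually_elim
      case (elim \<omega>)
      then show ?case using le_dyadic_sum[of "h \<omega>" N] by (simp add: A_def indicator_def of_bool_def)
    qed
  qed (intro Bochner_Integration.integrable_add Bochner_Integration.integrable_sum intA integrable_const)
  also have "\<dots> = 1/2 + (\<Sum>i<N. 2 ^ i / 2 * prob (A i))"
    using intA A by (subst Bochner_Integration.integral_add)
      (auto simp: prob_space Bochner_Integration.integral_sum intro!: Bochner_Integration.integrable_sum)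
  also have strict: "(\<Sum>i<N. 2 ^ i / 2 * prob (A i)) < 1 / 2"
  proof (cases "N = 0")
    case False
    have "(\<Sum>i<N. 2 ^ i / 2 * prob (A i)) < (\<Sum>i<N. 1 / (2 * real N))"
    proof (rule sum_strict_mono)
      fix i assume "i \<in> {..<N}"
      then show "2 ^ i / 2 * prob (A i) < 1 / (2 * real N)"
        using False small[of i] by (simp add: field_simps)
    qed (use False in auto)
    then show ?thesis using False by simp
  qed simp
  finally show False using h1 by simp
qed

text \<open>Parseval's identity: orthonormality removes the cross terms of the expanded square. It
  turns a unit coefficient vector into a function of second moment 1, as
  \<open>exists_dyadic_level\<close> requires.\<close>

lemma L2_orthonormal_combination:
  assumes "L2_orthonormal \<rho> m \<psi>"
  shows "integrable \<rho> (\<lambda>x. (cmod (\<Sum>k<m. v k * \<psi> k x))\<^sup>2)"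
    and "(\<integral>x. (cmod (\<Sum>k<m. v k * \<psi> k x))\<^sup>2 \<partial>\<rho>) = (\<Sum>k<m. (cmod (v k))\<^sup>2)"
proof -
  have L2: "\<psi> k \<in> borel_measurable \<rho>" "integrable \<rho> (\<lambda>x. (cmod (\<psi> k x))\<^sup>2)" if "k < m" for k
    using assms that by (auto simp: L2_orthonormal_def in_L2_def)
  have ortho: "(\<integral>x. \<psi> i x * cnj (\<psi> j x) \<partial>\<rho>) = (if i = j then 1 else 0)" if "i < m" "j < m" for i j
    using assms that by (auto simp: L2_orthonormal_def L2_inner_def)
  have int: "integrable \<rho> (\<lambda>x. \<psi> i x * cnj (\<psi> j x))" if "i < m" "j < m" for i j
  proof (rule Bochner_Integration.integrable_bound)
    show "integrable \<rho> (\<lambda>x. (cmod (\<psi> i x))\<^sup>2 + (cmod (\<psi> j x))\<^sup>2)"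
      using L2 that by auto
    show "(\<lambda>x. \<psi> i x * cnj (\<psi> j x)) \<in> borel_measurable \<rho>"
    proof -
      have [measurable]: "cnj \<in> borel_measurable borel"
        by (intro borel_measurable_continuous_onI continuous_intros)
      have [measurable]: "\<psi> i \<in> borel_measurable \<rho>" "\<psi> j \<in> borel_measurable \<rho>"
        using L2(1) that by auto
      show ?thesis by measurable
    qed
    have "a * b \<le> a\<^sup>2 + b\<^sup>2" if "a \<ge> 0" "b \<ge> 0" for a b :: real
      using sum_squares_bound[of a b] mult_nonneg_nonneg[OF that] by linarith
    then show "AE x in \<rho>. norm (\<psi> i x * cnj (\<psi> j x)) \<le> norm ((cmod (\<psi> i x))\<^sup>2 + (cmod (\<psi> j x))\<^sup>2)"
      by (simp add: norm_mult)
  qed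
  have expand: "complex_of_real ((cmod (\<Sum>k<m. v k * \<psi> k x))\<^sup>2)
      = (\<Sum>i<m. \<Sum>j<m. (v i * cnj (v j)) * (\<psi> i x * cnj (\<psi> j x)))" for x
    by (simp only: complex_norm_square cnj_sum complex_cnj_mult sum_product) (simp add: mult_ac)
  have "integrable \<rho> (\<lambda>x. complex_of_real ((cmod (\<Sum>k<m. v k * \<psi> k x))\<^sup>2))"
    unfolding expand by (intro Bochner_Integration.integrable_sum integrable_mult_right) (auto intro: int)
  then show "integrable \<rho> (\<lambda>x. (cmod (\<Sum>k<m. v k * \<psi> k x))\<^sup>2)"
    using integrable_Re[of \<rho>] by fastforce
  have "complex_of_real (\<integral>x. (cmod (\<Sum>k<m. v k * \<psi> k x))\<^sup>2 \<partial>\<rho>)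
      = (\<integral>x. (\<Sum>i<m. \<Sum>j<m. (v i * cnj (v j)) * (\<psi> i x * cnj (\<psi> j x))) \<partial>\<rho>)"
    by (simp only: integral_complex_of_real[symmetric] expand)
  also have "\<dots> = (\<Sum>i<m. \<integral>x. (\<Sum>j<m. (v i * cnj (v j)) * (\<psi> i x * cnj (\<psi> j x))) \<partial>\<rho>)"
    by (intro Bochner_Integration.integral_sum Bochner_Integration.integrable_sum integrable_mult_right int) auto
  also have "\<dots> = (\<Sum>i<m. \<Sum>j<m. \<integral>x. (v i * cnj (v j)) * (\<psi> i x * cnj (\<psi> j x)) \<partial>\<rho>)"
    by (intro sum.cong refl Bochner_Integration.integral_sum integrable_mult_right int) auto
  also have "\<dots> = (\<Sum>i<m. \<Sum>j<m. (v i * cnj (v j)) * (if i = j then 1 else 0))"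
    by (intro sum.cong refl) (simp add: ortho)
  also have "\<dots> = (\<Sum>i<m. v i * cnj (v i))"
    by (intro sum.cong refl) (simp add: if_distrib[where f = "\<lambda>x. _ * x"] cong: if_cong)
  also have "\<dots> = complex_of_real (\<Sum>i<m. (cmod (v i))\<^sup>2)"
    by (simp add: complex_norm_square[symmetric])
  finally show "(\<integral>x. (cmod (\<Sum>k<m. v k * \<psi> k x))\<^sup>2 \<partial>\<rho>) = (\<Sum>k<m. (cmod (v k))\<^sup>2)"
    by (simp only: of_real_eq_iff)
qed

subsection \<open>Kernel vectors and sparse averages\<close>

text \<open>In coefficients this is the average of \<open>t\<close> vectors, each with the single
  nonzero entry \<open>R * u\<close> at index \<open>j\<close> when \<open>g k = (j, u)\<close>.
  Such averages are \<open>t\<close>-sparse and, unlike \<open>v\<close>, finite in number.\<close>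

definition vertex_average :: "real \<Rightarrow> (nat \<Rightarrow> 'a \<Rightarrow> complex) \<Rightarrow> nat \<Rightarrow> (nat \<Rightarrow> nat \<times> complex) \<Rightarrow> 'a \<Rightarrow> complex" where
  "vertex_average R \<psi> t g y = (\<Sum>k<t. of_real R * snd (g k) * \<psi> (fst (g k)) y) / of_nat t"

text \<open>The default \<open>(0, 1)\<close> agrees with that of the \<open>Pi_pmf\<close> in
  \<open>exists_vertex_average\<close>, so random choices lie in this set; fixing it also makes the
  set finite for the union bound.\<close>

definition vertex_choices :: "nat \<Rightarrow> nat \<Rightarrow> (nat \<Rightarrow> nat \<times> complex) set" where
  "vertex_choices m t = PiE_dflt {..<t} (0, 1) (\<lambda>_. {..<m} \<times> {1, -1, \<i>, -\<i>})"

lemma finite_vertex_choices: "finite (vertex_choices m t)"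
  unfolding vertex_choices_def by (rule finite_PiE_dflt) auto

lemma card_vertex_choices: "card (vertex_choices m t) = (4 * m) ^ t"
proof -
  have "card {1, -1, \<i>, -\<i>} = 4" by (simp add: complex_eq_iff)
  then show ?thesis
    unfolding vertex_choices_def by (subst card_PiE_dflt) (auto simp: card_cartesian_product)
qed

lemma vertex_average_measurable:
  assumes "g \<in> vertex_choices m t" "\<And>k. k < m \<Longrightarrow> \<psi> k \<in> borel_measurable \<rho>"
  shows "vertex_average R \<psi> t g \<in> borel_measurable \<rho>"
proof -
  have "fst (g k) < m" if "k < t" for k
    using assms(1) that by (force simp: vertex_choices_def PiE_dflt_def)
  then have [measurable]: "\<psi> (fst (g k)) \<in> borel_measurable \<rho>" if "k \<in> {..<t}" for k
    using assms(2) that by auto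
  show ?thesis unfolding vertex_average_def by measurable
qed

text \<open>Probabilistic method, with the sample points held fixed. For random vertices of mean
  \<open>v\<close>, the expected \<open>\<rho>\<close>-measure and the expected fraction of sample
  points where the approximation fails add up to at most \<open>\<eta>\<close>. Both are
  nonnegative, so a single \<open>g\<close> controls them simultaneously.\<close>

lemma exists_vertex_average:
  fixes v :: "nat \<Rightarrow> complex" and x :: "nat \<Rightarrow> 'a"
  assumes \<rho>: "prob_space \<rho>" and m: "m > 0" and R: "R > 0" and B: "B > 0" and n: "n > 0" and t: "t > 0"
    and r: "r \<ge> 0"
    and meas: "\<And>k. k < m \<Longrightarrow> \<psi> k \<in> borel_measurable \<rho>"
    and bdd: "AE y in \<rho>. \<forall>k<m. cmod (\<psi> k y) \<le> B"
    and bdd_x: "\<And>j k. j < n \<Longrightarrow> k < m \<Longrightarrow> cmod (\<psi> k (x j)) \<le> B"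
    and v: "(\<Sum>k<m. cmod (v k)) \<le> R / 2"
    and tail: "8 * exp (- (real t * r\<^sup>2 / (8 * (R * B)\<^sup>2))) \<le> \<eta>"
  shows "\<exists>g\<in>vertex_choices m t.
      measure \<rho> {y \<in> space \<rho>. r < cmod (vertex_average R \<psi> t g y - (\<Sum>k<m. v k * \<psi> k y))} \<le> \<eta> \<and>
      real (card {j. j < n \<and> r < cmod (vertex_average R \<psi> t g (x j) - (\<Sum>k<m. v k * \<psi> k (x j)))}) \<le> real n * \<eta>"
proof -
  obtain p where p: "set_pmf p \<subseteq> {..<m} \<times> {1, -1, \<i>, -\<i>}"
    and Ep: "\<And>f. measure_pmf.expectation p (\<lambda>i. of_real R * snd i * f (fst i)) = (\<Sum>k<m. v k * f k)"
    using expectation_l1_vertices[OF m R v] by blast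
  have finp: "finite (set_pmf p)" using p by (rule finite_subset) auto
  let ?M = "Pi_pmf {..<t} (0, 1) (\<lambda>_. p)"
  let ?e = "4 * exp (- (real t * r\<^sup>2 / (8 * (R * B)\<^sup>2)))"
  define a where "a g = measure \<rho> {y \<in> space \<rho>.
    r < cmod (vertex_average R \<psi> t g y - (\<Sum>k<m. v k * \<psi> k y))}" for g
  define J where "J g = {j. j < n \<and>
    r < cmod (vertex_average R \<psi> t g (x j) - (\<Sum>k<m. v k * \<psi> k (x j)))}" for g
  define b where "b g = real (card (J g)) / real n" for g
  have E_comb: "measure_pmf.expectation p (\<lambda>i. of_real R * snd i * \<psi> (fst i) y) = (\<Sum>k<m. v k * \<psi> k y)" for y
    using Ep[of "\<lambda>k. \<psi> k y"] .
  have RB: "R * B > 0" using R B by simp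
  have Fbound: "cmod (of_real R * snd i * c (fst i)) \<le> R * B"
    if "i \<in> set_pmf p" "\<forall>k<m. cmod (c k) \<le> B" for i and c :: "nat \<Rightarrow> complex"
  proof -
    have "fst i < m" "cmod (snd i) = 1" using p that(1) by (force, force)
    then show ?thesis using that(2) R by (simp add: norm_mult)
  qed
  have Ea: "measure_pmf.expectation ?M a \<le> ?e"
  proof -
    have "AE y in \<rho>. \<forall>i\<in>set_pmf p. cmod (of_real R * snd i * \<psi> (fst i) y) \<le> R * B"
      using bdd by eventually_elim (auto intro: Fbound)
    moreover have "(\<lambda>y. of_real R * snd i * \<psi> (fst i) y) \<in> borel_measurable \<rho>" if "i \<in> set_pmf p" for i
      using meas[of "fst i"] p that by force
    ultimately show ?thesis
      using expectation_Pi_pmf_average_tail[OF \<rho> finp, of "\<lambda>i y. of_real R * snd i * \<psi> (fst i) y" "R * B" t r "(0, 1)"]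
        RB t r by (simp add: a_def[abs_def] vertex_average_def E_comb)
  qed
  have Eb: "measure_pmf.expectation ?M b \<le> ?e"
  proof -
    \<comment> \<open>The fraction of bad sample points is a probability under the uniform
      distribution on indices, so the same tail estimate covers it.\<close>
    have b_eq: "b = (\<lambda>g. measure (measure_pmf (pmf_of_set {..<n}))
      {j \<in> space (measure_pmf (pmf_of_set {..<n})).
        r < cmod (vertex_average R \<psi> t g (x j) - (\<Sum>k<m. v k * \<psi> k (x j)))})"
    proof
      fix g
      have "{..<n} \<inter> {j. r < cmod (vertex_average R \<psi> t g (x j) - (\<Sum>k<m. v k * \<psi> k (x j)))} = J g"
        by (auto simp: J_def)
      then show "b g = measure (measure_pmf (pmf_of_set {..<n}))
          {j \<in> space (measure_pmf (pmf_of_set {..<n})).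
            r < cmod (vertex_average R \<psi> t g (x j) - (\<Sum>k<m. v k * \<psi> k (x j)))}"
        using n by (subst measure_pmf_of_set) (auto simp: b_def)
    qed
    have "AE j in measure_pmf (pmf_of_set {..<n}).
        \<forall>i\<in>set_pmf p. cmod (of_real R * snd i * \<psi> (fst i) (x j)) \<le> R * B"
      unfolding AE_measure_pmf_iff
    proof (intro ballI)
      fix j i assume "j \<in> set_pmf (pmf_of_set {..<n})" and i: "i \<in> set_pmf p"
      moreover have "{..<n} \<noteq> {}" using n by auto
      ultimately have "j < n" by simp
      then show "cmod (of_real R * snd i * \<psi> (fst i) (x j)) \<le> R * B"
        using bdd_x by (intro Fbound[OF i, where c = "\<lambda>k. \<psi> k (x j)"]) auto
    qed
    then show ?thesis
      using expectation_Pi_pmf_average_tail[OF prob_space_measure_pmf finp,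
          of "\<lambda>i j. of_real R * snd i * \<psi> (fst i) (x j)" "pmf_of_set {..<n}" "R * B" t r "(0, 1)"]
        RB t r by (simp add: b_eq vertex_average_def E_comb)
  qed
  have finM: "finite (set_pmf ?M)"
    by (subst set_Pi_pmf) (auto intro!: finite_PiE_dflt finp)
  have "\<exists>g\<in>set_pmf ?M. a g + b g \<le> \<eta>"
  proof (rule ccontr)
    assume "\<not> ?thesis"
    then have "\<eta> < a g + b g" if "g \<in> set_pmf ?M" for g using that by force
    then have "measure_pmf.expectation ?M (\<lambda>g. a g + b g) > \<eta>"
      by (intro measure_pmf.expectation_greater integrable_measure_pmf_finite finM)
        (auto simp: AE_measure_pmf_iff)
    also have "measure_pmf.expectation ?M (\<lambda>g. a g + b g)
        = measure_pmf.expectation ?M a + measure_pmf.expectation ?M b"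
      by (intro Bochner_Integration.integral_add integrable_measure_pmf_finite finM)
    finally show False using Ea Eb tail by simp
  qed
  then obtain g where g: "g \<in> set_pmf ?M" and ab: "a g + b g \<le> \<eta>" by blast
  have "g \<in> vertex_choices m t"
    using g p by (auto simp: set_Pi_pmf vertex_choices_def PiE_dflt_def)
  moreover have "a g \<ge> 0" "b g \<ge> 0" by (auto simp: a_def b_def)
  then have "a g \<le> \<eta>" "b g \<le> \<eta>" using ab by auto
  then have "a g \<le> \<eta>" "real (card (J g)) \<le> real n * \<eta>"
    using n by (auto simp: b_def field_simps)
  ultimately show ?thesis unfolding a_def J_def by blast
qed

text \<open>Level \<open>i\<close> of the dyadic decomposition has threshold \<open>2 ^ i / 2\<close> for the squared modulus; the
  approximation error is half of its square root.\<close>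

lemma kernel_vector_bad_average:
  fixes v :: "nat \<Rightarrow> complex" and x :: "nat \<Rightarrow> 'a" and t :: "nat \<Rightarrow> nat"
  assumes \<rho>: "prob_space \<rho>" and ortho: "L2_orthonormal \<rho> m \<psi>"
    and m: "m > 0" and R: "R > 0" and B: "B > 0" and n: "n > 0" and t: "\<And>i. t i > 0"
    and bdd: "AE y in \<rho>. \<forall>k<m. cmod (\<psi> k y) \<le> B"
    and x: "\<And>j. j < n \<Longrightarrow> x j \<in> space \<rho>"
    and bdd_x: "\<And>j k. j < n \<Longrightarrow> k < m \<Longrightarrow> cmod (\<psi> k (x j)) \<le> B"
    and v1: "(\<Sum>k<m. cmod (v k)) \<le> R / 2" and v2: "(\<Sum>k<m. (cmod (v k))\<^sup>2) = 1"
    and ker: "\<And>j. j < n \<Longrightarrow> (\<Sum>k<m. v k * \<psi> k (x j)) = 0"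
    and N: "(R * B / 2)\<^sup>2 \<le> 2 ^ N / 2"
    and tail: "\<And>i. i < N \<Longrightarrow> 8 * exp (- (real (t i) * 2 ^ i / (64 * (R * B)\<^sup>2))) \<le> 1 / (4 * real N * 2 ^ i)"
  shows "\<exists>i<N. \<exists>g\<in>vertex_choices m (t i).
      3 / (4 * real N * 2 ^ i) \<le> measure \<rho> {y \<in> space \<rho>. sqrt (2 ^ i / 8) < cmod (vertex_average R \<psi> (t i) g y)} \<and>
      real (card {j. j < n \<and> x j \<in> {y \<in> space \<rho>. sqrt (2 ^ i / 8) < cmod (vertex_average R \<psi> (t i) g y)}})
        \<le> real n / (4 * real N * 2 ^ i)"
proof -
  interpret prob_space \<rho> by fact
  let ?f = "\<lambda>y. \<Sum>k<m. v k * \<psi> k y"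
  have meas: "\<psi> k \<in> borel_measurable \<rho>" if "k < m" for k
    using ortho that by (auto simp: L2_orthonormal_def in_L2_def)
  have f_meas[measurable]: "?f \<in> borel_measurable \<rho>"
    using meas by (intro borel_measurable_sum borel_measurable_times) auto
  \<comment> \<open>The modulus is at most \<open>B\<close> times the l1 norm of \<open>v\<close>,
    so the levels below \<open>N\<close> exhaust the range of its square.\<close>
  have "AE y in \<rho>. (cmod (?f y))\<^sup>2 \<le> 2 ^ N / 2"
    using bdd
  proof eventually_elim
    case (elim y)
    have "cmod (?f y) \<le> (\<Sum>k<m. cmod (v k) * B)"
      using elim by (intro sum_norm_le) (auto simp: norm_mult intro!: mult_left_mono)
    also have "\<dots> = (\<Sum>k<m. cmod (v k)) * B" by (simp add: sum_distrib_right)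
    also have "\<dots> \<le> R / 2 * B" using v1 B by (intro mult_right_mono) auto
    finally have "cmod (?f y) \<le> R * B / 2" by simp
    then have "(cmod (?f y))\<^sup>2 \<le> (R * B / 2)\<^sup>2" by (intro power_mono) auto
    then show ?case using N by simp
  qed
  then obtain i where i: "i < N"
    and level: "1 / (real N * 2 ^ i) \<le> prob {y \<in> space \<rho>. 2 ^ i / 2 < (cmod (?f y))\<^sup>2}"
    using exists_dyadic_level[of "\<lambda>y. (cmod (?f y))\<^sup>2" N] L2_orthonormal_combination[OF ortho, of v] v2
    by auto
  \<comment> \<open>With \<open>?r\<^sup>2 = 2 ^ i / 8\<close> the denominator 8 of the tail
    exponent becomes the 64 of \<open>tail\<close>. The choice of \<open>?\<eta>\<close> spends a
    quarter of the probability of the level, leaving three quarters for the average.\<close>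
  let ?r = "sqrt (2 ^ i / 8)" and ?\<eta> = "1 / (4 * real N * 2 ^ i)"
  have "8 * exp (- (real (t i) * ?r\<^sup>2 / (8 * (R * B)\<^sup>2))) \<le> ?\<eta>"
    using tail[OF i] by simp
  then have "\<exists>g\<in>vertex_choices m (t i).
      prob {y \<in> space \<rho>. ?r < cmod (vertex_average R \<psi> (t i) g y - ?f y)} \<le> ?\<eta> \<and>
      real (card {j. j < n \<and> ?r < cmod (vertex_average R \<psi> (t i) g (x j) - ?f (x j))}) \<le> real n * ?\<eta>"
    by (intro exists_vertex_average[OF \<rho> m R B n t _ meas bdd bdd_x v1]) auto
  then obtain g where g: "g \<in> vertex_choices m (t i)"
    and g1: "prob {y \<in> space \<rho>. ?r < cmod (vertex_average R \<psi> (t i) g y - ?f y)} \<le> ?\<eta>"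
    and g2: "real (card {j. j < n \<and> ?r < cmod (vertex_average R \<psi> (t i) g (x j) - ?f (x j))}) \<le> real n * ?\<eta>"
    by blast
  define z where "z = vertex_average R \<psi> (t i) g"
  have [measurable]: "z \<in> borel_measurable \<rho>"
    unfolding z_def using g meas by (rule vertex_average_measurable)
  \<comment> \<open>The square root of the threshold is \<open>2 * ?r\<close>: where
    \<open>?f\<close> exceeds it in modulus, either \<open>z\<close> exceeds \<open>?r\<close> or
    \<open>z\<close> misses \<open>?f\<close> by more than \<open>?r\<close>.\<close>
  have "{y \<in> space \<rho>. 2 ^ i / 2 < (cmod (?f y))\<^sup>2}
      \<subseteq> {y \<in> space \<rho>. ?r < cmod (z y)} \<union> {y \<in> space \<rho>. ?r < cmod (z y - ?f y)}"
  proof (rule subsetI, rule ccontr)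
    fix y assume y: "y \<in> {y \<in> space \<rho>. 2 ^ i / 2 < (cmod (?f y))\<^sup>2}"
      and "y \<notin> {y \<in> space \<rho>. ?r < cmod (z y)} \<union> {y \<in> space \<rho>. ?r < cmod (z y - ?f y)}"
    then have "cmod (z y) \<le> ?r" "cmod (z y - ?f y) \<le> ?r" by auto
    then have "cmod (?f y) \<le> 2 * ?r"
      using norm_triangle_ineq4[of "z y" "z y - ?f y"] by simp
    then have "(cmod (?f y))\<^sup>2 \<le> (2 * ?r)\<^sup>2" by (intro power_mono) auto
    also have "\<dots> = 2 ^ i / 2" by (simp add: power_mult_distrib)
    finally show False using y by simp
  qed
  then have "prob {y \<in> space \<rho>. 2 ^ i / 2 < (cmod (?f y))\<^sup>2}
      \<le> prob ({y \<in> space \<rho>. ?r < cmod (z y)} \<union> {y \<in> space \<rho>. ?r < cmod (z y - ?f y)})"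
    by (rule finite_measure_mono) measurable
  also have "\<dots> \<le> prob {y \<in> space \<rho>. ?r < cmod (z y)} + prob {y \<in> space \<rho>. ?r < cmod (z y - ?f y)}"
    by (rule measure_Un_le; measurable)
  finally have split: "prob {y \<in> space \<rho>. 2 ^ i / 2 < (cmod (?f y))\<^sup>2}
      \<le> prob {y \<in> space \<rho>. ?r < cmod (z y)} + prob {y \<in> space \<rho>. ?r < cmod (z y - ?f y)}" .
  have arith: "a - b \<le> c" if "a \<le> p" "p \<le> c + d" "d \<le> b" for a b c d p :: real
    using that by linarith
  have "1 / (real N * 2 ^ i) - ?\<eta> \<le> prob {y \<in> space \<rho>. ?r < cmod (z y)}"
    by (rule arith[OF level split g1[folded z_def]])
  moreover have "1 / (real N * 2 ^ i) - ?\<eta> = 3 / (4 * real N * 2 ^ i)"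
    using i by (simp add: field_simps)
  \<comment> \<open>The kernel hypothesis enters here: \<open>?f\<close> vanishes at the sample
    points, so a large value of \<open>z\<close> there is an approximation error, which is rare by
    \<open>g2\<close>.\<close>
  moreover have "{j. j < n \<and> x j \<in> {y \<in> space \<rho>. ?r < cmod (z y)}}
      = {j. j < n \<and> ?r < cmod (vertex_average R \<psi> (t i) g (x j) - ?f (x j))}"
    using x ker by (auto simp: z_def)
  ultimately show ?thesis
    using i g g2 unfolding z_def by (intro exI[of _ i] conjI bexI[of _ g]) auto
qed

text \<open>The averages that are large with \<open>\<rho>\<close>-probability at least
  \<open>q i\<close> form a finite set fixed before sampling. By \<open>prob_count_le_third\<close>
  and a union bound, it is unlikely that any of them is large on too few sample points; otherwise
  \<open>kernel_vector_bad_average\<close> excludes nonzero kernel vectors in the cone.\<close>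

lemma (in prob_space) kernel_event:
  fixes X :: "nat \<Rightarrow> 'a \<Rightarrow> 'b" and t :: "nat \<Rightarrow> nat"
  assumes \<rho>: "prob_space \<rho>" and ortho: "L2_orthonormal \<rho> m \<psi>"
    and m: "m > 0" and R: "R > 0" and B: "B > 0" and n: "n > 0" and t: "\<And>i. t i > 0"
    and bdd: "AE y in \<rho>. \<forall>k<m. cmod (\<psi> k y) \<le> B"
    and iid: "iid_sample M \<rho> n X"
    and N: "(R * B / 2)\<^sup>2 \<le> 2 ^ N / 2"
    and tail: "\<And>i. i < N \<Longrightarrow> 8 * exp (- (real (t i) * 2 ^ i / (64 * (R * B)\<^sup>2))) \<le> 1 / (4 * real N * 2 ^ i)"
    and union: "(\<Sum>i<N. real (4 * m) ^ t i * exp (- (real n / (8 * real N * 2 ^ i)))) \<le> \<epsilon>"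
  shows "\<exists>E\<in>events. prob E \<ge> 1 - \<epsilon> \<and> (\<forall>\<omega>\<in>E. \<forall>v :: nat \<Rightarrow> complex.
    (\<forall>j<n. (\<Sum>k<m. v k * \<psi> k (X j \<omega>)) = 0) \<longrightarrow>
    (\<Sum>k<m. cmod (v k)) \<le> R / 2 * sqrt (\<Sum>k<m. (cmod (v k))\<^sup>2) \<longrightarrow> (\<forall>k<m. v k = 0))"
proof -
  have indep: "indep_vars (\<lambda>_. \<rho>) X {..<n}" and distr: "\<And>j. j < n \<Longrightarrow> distr M \<rho> (X j) = \<rho>"
    using iid by (auto simp: iid_sample_def)
  have X[measurable]: "X j \<in> measurable M \<rho>" if "j < n" for j
    using indep that by (auto simp: indep_vars_def)
  have meas: "\<psi> k \<in> borel_measurable \<rho>" if "k < m" for k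
    using ortho that by (auto simp: L2_orthonormal_def in_L2_def)
  define A where "A i g = {y \<in> space \<rho>. sqrt (2 ^ i / 8) < cmod (vertex_average R \<psi> (t i) g y)}" for i g
  \<comment> \<open>This is the measure guaranteed by \<open>kernel_vector_bad_average\<close>, and
    \<open>q i / 3\<close> is exactly the sample frequency \<open>1 / (4 * N * 2 ^ i)\<close> there,
    matching the third in the Chernoff bound.\<close>
  define q where "q i = 3 / (4 * real N * 2 ^ i)" for i :: nat
  define S where "S = (SIGMA i:{..<N}. {g \<in> vertex_choices m (t i). q i \<le> measure \<rho> (A i g)})"
  define bad where "bad i g = {\<omega> \<in> space M. real (card {j. j < n \<and> X j \<omega> \<in> A i g}) \<le> real n * q i / 3}" for i g
  define Bad where "Bad = (\<Union>p\<in>S. bad (fst p) (snd p))"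
  have finS: "finite S"
    unfolding S_def by (intro finite_SigmaI) (auto intro: finite_subset[OF _ finite_vertex_choices])
  have A: "A i g \<in> sets \<rho>" if "g \<in> vertex_choices m (t i)" for i g
  proof -
    have [measurable]: "vertex_average R \<psi> (t i) g \<in> borel_measurable \<rho>"
      using that meas by (rule vertex_average_measurable)
    show ?thesis unfolding A_def by measurable
  qed
  have bad: "bad i g \<in> events" "prob (bad i g) \<le> exp (- (real n * q i / 6))" if "(i, g) \<in> S" for i g
  proof -
    have g: "g \<in> vertex_choices m (t i)" and q: "q i \<le> measure \<rho> (A i g)"
      using that by (auto simp: S_def)
    have q': "q i \<le> prob (X j -` A i g \<inter> space M)" if "j < n" for j
      using q measure_distr[OF X[OF that] A[OF g]] distr[OF that] by simp
    show "bad i g \<in> events"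
      unfolding bad_def by (rule prob_count_le_third(1)[OF indep A[OF g] q'])
    show "prob (bad i g) \<le> exp (- (real n * q i / 6))"
      unfolding bad_def by (rule prob_count_le_third(2)[OF indep A[OF g] q'])
  qed
  have bad_events: "Bad \<in> events"
    unfolding Bad_def using finS bad(1) by (intro sets.finite_UN) auto
  have "prob Bad \<le> (\<Sum>p\<in>S. prob (bad (fst p) (snd p)))"
    unfolding Bad_def using bad(1) by (intro measure_UNION_le[OF finS]) auto
  also have "\<dots> \<le> (\<Sum>p\<in>S. exp (- (real n * q (fst p) / 6)))"
    using bad(2) by (intro sum_mono) auto
  also have "\<dots> \<le> (\<Sum>p\<in>(SIGMA i:{..<N}. vertex_choices m (t i)). exp (- (real n * q (fst p) / 6)))"
    by (intro sum_mono2) (auto simp: S_def intro!: finite_SigmaI finite_vertex_choices)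
  also have "\<dots> = (\<Sum>i<N. \<Sum>g\<in>vertex_choices m (t i). exp (- (real n * q i / 6)))"
    by (subst sum.Sigma) (auto simp: finite_vertex_choices case_prod_unfold)
  also have "\<dots> = (\<Sum>i<N. real (4 * m) ^ t i * exp (- (real n * q i / 6)))"
    by (simp add: card_vertex_choices)
  finally have "prob Bad \<le> (\<Sum>i<N. real (4 * m) ^ t i * exp (- (real n * q i / 6)))" .
  moreover have "real n * q i / 6 = real n / (8 * real N * 2 ^ i)" for i
    by (simp add: q_def)
  ultimately have Bad: "prob Bad \<le> \<epsilon>" using union by simp
  \<comment> \<open>The dictionary is bounded only almost everywhere, but the bound is needed at
    each sample point. It holds there almost surely because each \<open>X j\<close> has law
    \<open>\<rho>\<close>.\<close>
  define Bdd where "Bdd = {\<omega> \<in> space M. \<forall>j<n. \<forall>k<m. cmod (\<psi> k (X j \<omega>)) \<le> B}"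
  define E where "E = (space M - Bad) \<inter> Bdd"
  have Bdd_events: "Bdd \<in> events"
  proof -
    have [measurable]: "(\<lambda>\<omega>. \<psi> k (X j \<omega>)) \<in> borel_measurable M" if "j < n" "k < m" for j k
      using X[OF that(1)] meas[OF that(2)] by (rule measurable_compose)
    have "{\<omega> \<in> space M. \<forall>j\<in>{..<n}. \<forall>k\<in>{..<m}. cmod (\<psi> k (X j \<omega>)) \<le> B} \<in> events"
      by (intro sets.sets_Collect_finite_All) auto
    then show ?thesis by (simp add: Bdd_def Ball_def)
  qed
  have "AE \<omega> in M. \<forall>k<m. cmod (\<psi> k (X j \<omega>)) \<le> B" if "j < n" for j
    by (rule AE_distrD[OF X[OF that]]) (simp only: distr[OF that] bdd)
  then have "AE \<omega> in M. \<forall>j\<in>{..<n}. \<forall>k<m. cmod (\<psi> k (X j \<omega>)) \<le> B"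
    by (intro AE_finite_allI) auto
  then have "AE \<omega> in M. \<omega> \<in> Bdd" using AE_space by eventually_elim (auto simp: Bdd_def)
  then have "prob E = prob (space M - Bad)"
    using bad_events Bdd_events by (intro finite_measure_eq_AE) (auto simp: E_def)
  also have "\<dots> = 1 - prob Bad" using bad_events by (rule prob_compl)
  finally have "prob E \<ge> 1 - \<epsilon>" using Bad by simp
  moreover have "E \<in> events" using bad_events Bdd_events by (auto simp: E_def)
  moreover have "v k = 0" if \<omega>: "\<omega> \<in> E" and ker: "\<forall>j<n. (\<Sum>k<m. v k * \<psi> k (X j \<omega>)) = 0"
    and cone: "(\<Sum>k<m. cmod (v k)) \<le> R / 2 * sqrt (\<Sum>k<m. (cmod (v k))\<^sup>2)" and k: "k < m"
    for \<omega> k and v :: "nat \<Rightarrow> complex"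
  proof (rule ccontr)
    assume "v k \<noteq> 0"
    define a where "a = sqrt (\<Sum>k<m. (cmod (v k))\<^sup>2)"
    have "0 < (cmod (v k))\<^sup>2" using \<open>v k \<noteq> 0\<close> by simp
    also have "\<dots> \<le> (\<Sum>k<m. (cmod (v k))\<^sup>2)" using k by (intro member_le_sum) auto
    finally have pos: "(\<Sum>k<m. (cmod (v k))\<^sup>2) > 0" .
    then have a: "a > 0" "a\<^sup>2 = (\<Sum>k<m. (cmod (v k))\<^sup>2)" by (auto simp: a_def)
    \<comment> \<open>Kernel and cone are invariant under scaling, so \<open>v\<close> may be
      normalised.\<close>
    define w where "w k = v k / of_real a" for k
    have cw: "cmod (w k) = cmod (v k) / a" for k
      using a by (simp add: w_def norm_divide)
    have w2: "(\<Sum>k<m. (cmod (w k))\<^sup>2) = 1"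
      using a pos by (simp add: cw power_divide flip: sum_divide_distrib)
    have w1: "(\<Sum>k<m. cmod (w k)) \<le> R / 2"
      using a cone by (simp add: cw field_simps flip: sum_divide_distrib a_def)
    have wker: "(\<Sum>k<m. w k * \<psi> k (X j \<omega>)) = 0" if "j < n" for j
      using ker that by (simp add: w_def flip: sum_divide_distrib)
    have \<omega>': "\<omega> \<in> space M" "\<omega> \<in> Bdd" "\<omega> \<notin> Bad" using \<omega> by (auto simp: E_def)
    have "\<exists>i<N. \<exists>g\<in>vertex_choices m (t i). q i \<le> measure \<rho> (A i g) \<and>
        real (card {j. j < n \<and> X j \<omega> \<in> A i g}) \<le> real n / (4 * real N * 2 ^ i)"
      unfolding A_def q_def
      by (rule kernel_vector_bad_average[where x = "\<lambda>j. X j \<omega>", OF \<rho> ortho m R B n t bdd _ _ w1 w2 wker N tail])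
        (use measurable_space[OF X \<omega>'(1)] \<omega>'(2) in \<open>auto simp: Bdd_def\<close>)
    then obtain i g where "i < N" "g \<in> vertex_choices m (t i)" "q i \<le> measure \<rho> (A i g)"
      "real (card {j. j < n \<and> X j \<omega> \<in> A i g}) \<le> real n / (4 * real N * 2 ^ i)"
      by blast
    then have "(i, g) \<in> S" "\<omega> \<in> bad i g"
      using \<omega>'(1) by (auto simp: S_def bad_def q_def)
    then show False using \<omega>'(3) by (auto simp: Bad_def)
  qed
  ultimately show ?thesis by blast
qed

subsection \<open>Sample size\<close>

text \<open>The cone constant \<open>4 * sqrt s\<close> is \<open>R / 2\<close> for
  \<open>R = 8 * sqrt s\<close>. After taking logarithms, level \<open>i\<close> of the union bound
  requires \<open>8 * N * 2 ^ i * (t i * ln (4 * m) + ln (2 * N / \<epsilon>)) \<le> n\<close>. With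
  \<open>N\<close> of order \<open>l\<close> and \<open>t i\<close> of order
  \<open>Q * l / 2 ^ i\<close>, the left side has order \<open>Q * l * (l * M + K)\<close>, the
  prescribed sample size.\<close>

lemma sample_size_parameters:
  fixes B \<epsilon> :: real and m s n :: nat
  assumes B: "1 \<le> B" and s: "1 \<le> s" and m: "1 \<le> m" and \<epsilon>: "0 < \<epsilon>" "\<epsilon> < 1"
    and n: "real n \<ge> 10 ^ 7 * B\<^sup>2 * real s * log_factor B m \<epsilon> s"
  obtains N :: nat and t :: "nat \<Rightarrow> nat" where "n > 0"
    "(8 * sqrt (real s) * B / 2)\<^sup>2 \<le> 2 ^ N / 2" "\<And>i. t i > 0"
    "\<And>i. i < N \<Longrightarrow> 8 * exp (- (real (t i) * 2 ^ i / (64 * (8 * sqrt (real s) * B)\<^sup>2))) \<le> 1 / (4 * real N * 2 ^ i)"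
    "(\<Sum>i<N. real (4 * m) ^ t i * exp (- (real n / (8 * real N * 2 ^ i)))) \<le> \<epsilon> / 2"
proof -
  define Q where "Q = 2 * B\<^sup>2 * real s"
  define l where "l = ln Q"
  define M where "M = ln (2 * real m)"
  define K where "K = ln (2 * inverse \<epsilon> * l)"
  have "1 \<le> B\<^sup>2 * real s"
    using B s mult_mono[of 1 "B\<^sup>2" 1 "real s"] by simp
  then have Q: "Q \<ge> 2" by (simp add: Q_def)
  have ln2: "ln 2 \<ge> (2/3::real)" by (rule ln2_ge_two_thirds)
  have l_ln2: "ln 2 \<le> l" using Q by (simp add: l_def)
  have l: "l \<ge> 1/2" using l_ln2 ln2 by linarith
  have "l \<le> Q" using ln_le_minus_one[of Q] Q by (simp add: l_def)
  have M: "ln 2 \<le> M" using m by (simp add: M_def)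
  have "1 \<le> 2 * inverse \<epsilon> * l"
    using l \<epsilon> by (simp add: field_simps)
  then have K: "K \<ge> 0" by (simp add: K_def)
  have n': "real n \<ge> 5000000 * Q * (l * (l * M + K))"
    using n by (simp add: log_factor_def Q_def l_def M_def K_def algebra_simps)
  have pos: "l * (l * M + K) > 0"
    using l M ln2 K by (intro mult_pos_pos add_pos_nonneg) auto
  then have "5000000 * Q * (l * (l * M + K)) > 0" using Q by simp
  then have n0: "n > 0" using n' by linarith
  \<comment> \<open>Since \<open>(R * B / 2)\<^sup>2 = 8 * Q\<close>, the levels suffice once
    \<open>16 * Q \<le> 2 ^ N\<close>.\<close>
  define N where "N = nat \<lceil>log 2 (16 * Q)\<rceil>"
  have logQ: "log 2 (16 * Q) = 4 + l / ln 2"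
  proof -
    have "log 2 (2 ^ 4 * Q) = 4 + log 2 Q" using Q by (subst log_mult) (auto simp del: power_numeral simp: log_nat_power)
    then show ?thesis by (simp add: l_def log_def)
  qed
  have "log 2 (16 * Q) \<ge> 1" using logQ l ln2 by (simp add: add_increasing2)
  then have N: "log 2 (16 * Q) \<le> real N" "real N \<le> log 2 (16 * Q) + 1" "N > 0"
    unfolding N_def by linarith+
  have "16 * Q = 2 powr log 2 (16 * Q)" using Q by simp
  also have "\<dots> \<le> 2 powr real N" using N by (intro powr_mono) auto
  finally have N_ge: "16 * Q \<le> 2 ^ N" by (simp add: powr_realpow)
  have "(2::real) ^ N = 2 powr real N" by (simp add: powr_realpow)
  also have "\<dots> \<le> 2 powr (log 2 (16 * Q) + 1)" using N by (intro powr_mono) auto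
  also have "\<dots> = 32 * Q" using Q by (simp add: powr_add)
  finally have N_le: "2 ^ N \<le> 32 * Q" .
  \<comment> \<open>Rounding gives \<open>N \<le> 5 + c \<le> 6 * c\<close> as
    \<open>c \<ge> 1\<close>, and \<open>1 / ln 2 \<le> 3 / 2\<close> turns this into
    \<open>9 * l\<close>.\<close>
  define c where "c = l / ln 2"
  have "c \<ge> 1" using l_ln2 ln2 by (simp add: c_def)
  then have "real N \<le> 6 * c" using N(2) logQ by (simp flip: c_def)
  moreover have "c \<le> l / (2/3)" unfolding c_def using l ln2 by (intro divide_left_mono) auto
  ultimately have N9: "real N \<le> 9 * l" by simp
  \<comment> \<open>Chosen so that \<open>8 * exp (- H) = 1 / (4 * N * 2 ^ N)\<close>, which meets
    the tail condition on all levels at once.\<close>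
  define H where "H = ln (32 * real N * 2 ^ N)"
  have "32 * real N * 2 ^ N \<le> 32 * (9 * Q) * (32 * Q)"
    using N9 N_le \<open>l \<le> Q\<close> Q by (intro mult_mono) auto
  also have "\<dots> \<le> 2 ^ 14 * Q ^ 2" by (simp add: power2_eq_square)
  finally have "H \<le> ln (2 ^ 14 * Q ^ 2)"
    unfolding H_def using N(3) Q by (subst ln_le_cancel_iff) auto
  also have "\<dots> = ln (2 ^ 14) + ln (Q ^ 2)" using Q by (intro ln_mult_pos) auto
  also have "ln (2 ^ 14 :: real) = 14 * ln 2" by (subst ln_realpow) auto
  also have "ln (Q ^ 2) = 2 * l" using Q by (simp add: ln_realpow l_def)
  finally have H16: "H \<le> 16 * l" using l_ln2 by linarith
  have "exp 1 \<le> (3::real)" by (rule exp_le)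
  also have "(3::real) \<le> 32 * 1 * 1" by simp
  also have "\<dots> \<le> 32 * real N * 2 ^ N" using N(3) by (intro mult_mono) auto
  finally have H1: "H \<ge> 1" unfolding H_def using N(3) by (subst ln_ge_iff) auto
  \<comment> \<open>The factor \<open>2048 = 64 * 32\<close> cancels the denominator
    \<open>64 * (32 * Q)\<close> of the tail exponent and leaves at least \<open>H\<close>. Rounding
    up costs at most \<open>32 * Q * H / 2 ^ i\<close>, whence the later 2080.\<close>
  define t where "t i = nat \<lceil>2048 * Q * H / 2 ^ i\<rceil>" for i :: nat
  have t0: "t i > 0" for i using Q H1 by (simp add: t_def)
  have RB: "(8 * sqrt (real s) * B)\<^sup>2 = 32 * Q" by (simp add: power_mult_distrib Q_def)
  have RB2: "(8 * sqrt (real s) * B / 2)\<^sup>2 \<le> 2 ^ N / 2"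
    unfolding power_divide RB using N_ge by simp
  have tail: "8 * exp (- (real (t i) * 2 ^ i / (64 * (8 * sqrt (real s) * B)\<^sup>2))) \<le> 1 / (4 * real N * 2 ^ i)"
    if i: "i < N" for i
  proof -
    have "2048 * Q * H / 2 ^ i \<le> real (t i)" unfolding t_def by linarith
    then have "H \<le> real (t i) * 2 ^ i / (64 * (32 * Q))" using Q by (simp add: field_simps)
    then have "exp (- (real (t i) * 2 ^ i / (64 * (32 * Q)))) \<le> exp (- H)" by simp
    also have "\<dots> = 1 / (32 * real N * 2 ^ N)"
      using N(3) by (simp add: H_def exp_minus inverse_eq_divide)
    also have "\<dots> \<le> 1 / (32 * real N * 2 ^ i)"
      using N(3) i by (intro divide_left_mono mult_left_mono power_increasing) auto
    finally show ?thesis using N(3) unfolding RB by (simp add: field_simps)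
  qed
  have "(\<Sum>i<N. real (4 * m) ^ t i * exp (- (real n / (8 * real N * 2 ^ i)))) \<le> (\<Sum>i<N. \<epsilon> / (2 * real N))"
  proof (rule sum_mono)
    fix i assume "i \<in> {..<N}"
    then have "(2::real) ^ i \<le> 2 ^ N" by (intro power_increasing) auto
    then have i32: "2 ^ i \<le> 32 * Q" using N_le by linarith
    have "1 \<le> 32 * Q * H / 2 ^ i"
      using i32 mult_mono[of "2 ^ i" "32 * Q" 1 H] H1 Q by (simp add: field_simps)
    moreover have "real (t i) \<le> 2048 * Q * H / 2 ^ i + 1"
      unfolding t_def using Q H1 by (simp add: of_nat_ceiling)
    ultimately have "real (t i) \<le> 2048 * Q * H / 2 ^ i + 32 * Q * H / 2 ^ i" by linarith
    also have "\<dots> = 2080 * Q * H / 2 ^ i" by (simp add: add_divide_distrib[symmetric])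
    finally have ti: "real (t i) * 2 ^ i \<le> 2080 * Q * H" by (simp add: field_simps)
    have "ln (2 * (2 * real m)) = ln 2 + M" unfolding M_def using m by (intro ln_mult_pos) auto
    then have "ln (real (4 * m)) = ln 2 + M" by simp
    then have m4: "ln (real (4 * m)) \<le> 2 * M" using M by linarith
    \<comment> \<open>Here \<open>2 * N \<le> 18 * l \<le> 2 ^ 4 * (2 * l)\<close>; the logarithm of
      the spare factor is then charged to \<open>l * M\<close>.\<close>
    have "2 * real N / \<epsilon> \<le> 2 ^ 4 * (2 * inverse \<epsilon> * l)"
      using N9 \<epsilon> l by (simp add: field_simps)
    then have "ln (2 * real N / \<epsilon>) \<le> ln (2 ^ 4 * (2 * inverse \<epsilon> * l))"
      using N(3) \<epsilon> l by (subst ln_le_cancel_iff) auto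
    also have "\<dots> = ln (2 ^ 4) + K" unfolding K_def using \<epsilon> l by (intro ln_mult_pos) auto
    also have "ln (2 ^ 4 :: real) = 4 * ln 2" by (subst ln_realpow) auto
    also have "4 * ln 2 \<le> 4 * M" using M by simp
    also have "4 * M \<le> 8 * (l * M)" using mult_right_mono[of "1/2" l M] l M ln2 by simp
    finally have lnN: "ln (2 * real N / \<epsilon>) \<le> 8 * (l * M) + K" by simp
    have "1 \<le> 2 * real N / \<epsilon>" using N(3) \<epsilon> by (simp add: field_simps)
    then have lnN0: "0 \<le> ln (2 * real N / \<epsilon>)" by simp
    have m0: "0 \<le> ln (real (4 * m))" using m by simp
    have ti16: "real (t i) * 2 ^ i \<le> 2080 * Q * (16 * l)"
      using H16 Q by (intro order_trans[OF ti] mult_left_mono) auto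
    have term1: "real (t i) * 2 ^ i * ln (real (4 * m)) \<le> 2080 * Q * (16 * l) * (2 * M)"
      by (rule mult_mono[OF ti16 m4 _ m0]) (use Q l in simp)
    have term2: "2 ^ i * ln (2 * real N / \<epsilon>) \<le> 32 * Q * (8 * (l * M) + K)"
      by (rule mult_mono[OF i32 lnN _ lnN0]) (use Q in simp)
    have "8 * real N \<le> 8 * (9 * l)" using N9 by simp
    moreover have "0 \<le> real (t i) * 2 ^ i * ln (real (4 * m)) + 2 ^ i * ln (2 * real N / \<epsilon>)"
      using lnN0 m0 by (intro add_nonneg_nonneg mult_nonneg_nonneg) auto
    moreover have "0 \<le> 8 * (9 * l)" using l by simp
    ultimately have "8 * real N * (real (t i) * 2 ^ i * ln (real (4 * m)) + 2 ^ i * ln (2 * real N / \<epsilon>))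
        \<le> 8 * (9 * l) * (2080 * Q * (16 * l) * (2 * M) + 32 * Q * (8 * (l * M) + K))"
      using mult_mono[OF _ add_mono[OF term1 term2], of "8 * real N" "8 * (9 * l)"] by blast
    \<comment> \<open>The coefficients are \<open>72 * 2080 * 32\<close>, \<open>72 * 32 * 8\<close>
      and \<open>72 * 32\<close>. The first two add up to less than 5000000, which becomes
      \<open>10 ^ 7\<close> because \<open>Q\<close> contains a factor 2.\<close>
    also have "\<dots> = 4792320 * (Q * (l * (l * M))) + 18432 * (Q * (l * (l * M))) + 2304 * (Q * (l * K))"
      by (simp add: algebra_simps)
    also have "\<dots> \<le> 5000000 * (Q * (l * (l * M))) + 5000000 * (Q * (l * K))"
    proof -
      have "0 \<le> Q * (l * (l * M))" "0 \<le> Q * (l * K)" using Q l M K ln2 by auto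
      then show ?thesis by linarith
    qed
    also have "\<dots> = 5000000 * Q * (l * (l * M + K))" by (simp add: algebra_simps)
    finally have "8 * real N * (real (t i) * 2 ^ i * ln (real (4 * m)) + 2 ^ i * ln (2 * real N / \<epsilon>)) \<le> real n"
      using n' by linarith
    then have "real (t i) * ln (real (4 * m)) + ln (2 * real N / \<epsilon>) \<le> real n / (8 * real N * 2 ^ i)"
      using N(3) by (simp add: field_simps)
    then have "real (t i) * ln (real (4 * m)) - real n / (8 * real N * 2 ^ i) \<le> - ln (2 * real N / \<epsilon>)"
      by linarith
    then have le: "exp (real (t i) * ln (real (4 * m)) - real n / (8 * real N * 2 ^ i)) \<le> exp (- ln (2 * real N / \<epsilon>))"
      by simp
    have eq1: "exp (- ln (2 * real N / \<epsilon>)) = \<epsilon> / (2 * real N)"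
      using N(3) \<epsilon> by (simp add: exp_minus)
    have eq2: "exp (real (t i) * ln (real (4 * m)) - real n / (8 * real N * 2 ^ i))
      = real (4 * m) ^ t i * exp (- (real n / (8 * real N * 2 ^ i)))"
    proof -
      have "exp (real (t i) * ln (real (4 * m))) = real (4 * m) ^ t i"
        unfolding exp_of_nat_mult using m by simp
      then show ?thesis
        using exp_add[of "real (t i) * ln (real (4 * m))" "- (real n / (8 * real N * 2 ^ i))"]
        unfolding add_uminus_conv_diff by simp
    qed
    show "real (4 * m) ^ t i * exp (- (real n / (8 * real N * 2 ^ i))) \<le> \<epsilon> / (2 * real N)"
      using le unfolding eq1 eq2 .
  qed
  also have "\<dots> = \<epsilon> / 2" using N(3) by simp
  finally show thesis using that[of N t] n0 RB2 t0 tail by blast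
qed

subsection \<open>Deterministic recovery\<close>

text \<open>In the cone the error \<open>h = y - x\<close> vanishes. Otherwise let \<open>S\<close>
  be the support of \<open>z\<close>: the norm comparison gives
  \<open>\<parallel>h\<parallel>\<^sub>1 \<le> 2 * \<parallel>h\<^sub>S\<parallel>\<^sub>1 + 2 *
  \<parallel>x - z\<parallel>\<^sub>1\<close>, and Cauchy-Schwarz bounds the first term by
  \<open>2 * sqrt s * \<parallel>h\<parallel>\<^sub>2\<close>. This is half of what failing the cone
  condition provides, so the final constant is 1.\<close>

lemma l1_minimizer_error:
  fixes x y z :: "nat \<Rightarrow> complex"
  assumes le: "(\<Sum>k<m. cmod (y k)) \<le> (\<Sum>k<m. cmod (x k))"
    and cone: "(\<Sum>k<m. cmod (y k - x k)) \<le> 4 * sqrt (real s) * sqrt (\<Sum>k<m. (cmod (y k - x k))\<^sup>2)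
      \<Longrightarrow> \<forall>k<m. y k - x k = 0"
    and z: "card {k. k < m \<and> z k \<noteq> 0} \<le> s"
  shows "sqrt (real s) * sqrt (\<Sum>k<m. (cmod (y k - x k))\<^sup>2) \<le> (\<Sum>k<m. cmod (x k - z k))"
proof -
  define a where "a = sqrt (\<Sum>k<m. (cmod (y k - x k))\<^sup>2)"
  show ?thesis
  proof (cases "(\<Sum>k<m. cmod (y k - x k)) \<le> 4 * sqrt (real s) * a")
    case True
    then have "\<forall>k<m. y k - x k = 0" unfolding a_def by (rule cone)
    then have "a = 0" by (simp add: a_def)
    then show ?thesis by (simp flip: a_def) (simp add: sum_nonneg)
  next
    case False
    let ?S = "{k. k < m \<and> z k \<noteq> 0}"
    \<comment> \<open>Off the support of \<open>z\<close> this is the triangle inequality for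
      \<open>y k - x k\<close>; on it, the reverse one.\<close>
    have point: "cmod (x k) - cmod (y k) \<le> 2 * (if k \<in> ?S then cmod (y k - x k) else 0)
        - cmod (y k - x k) + 2 * cmod (x k - z k)" if "k < m" for k
    proof (cases "z k = 0")
      case True
      then show ?thesis using norm_triangle_ineq4[of "y k" "x k"] by simp
    next
      case False
      then show ?thesis using that norm_triangle_ineq2[of "x k" "y k"]
        by (simp add: norm_minus_commute add_increasing2)
    qed
    have "(\<Sum>k<m. cmod (x k) - cmod (y k)) \<le> (\<Sum>k<m. 2 * (if k \<in> ?S then cmod (y k - x k) else 0)
        - cmod (y k - x k) + 2 * cmod (x k - z k))"
      using point by (intro sum_mono) auto
    also have "\<dots> = 2 * (\<Sum>k\<in>?S. cmod (y k - x k)) - (\<Sum>k<m. cmod (y k - x k))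
        + 2 * (\<Sum>k<m. cmod (x k - z k))"
    proof -
      have "(\<Sum>k<m. if k \<in> ?S then cmod (y k - x k) else 0) = (\<Sum>k\<in>?S. cmod (y k - x k))"
        by (rule sum.mono_neutral_cong_right) auto
      then show ?thesis
        by (simp only: sum.distrib sum_subtractf flip: sum_distrib_left)
    qed
    finally have l1: "(\<Sum>k<m. cmod (y k - x k)) \<le> 2 * (\<Sum>k\<in>?S. cmod (y k - x k)) + 2 * (\<Sum>k<m. cmod (x k - z k))"
      using le by (simp add: sum_subtractf)
    have "(\<Sum>k\<in>?S. cmod (y k - x k))\<^sup>2 \<le> (\<Sum>k\<in>?S. (cmod (y k - x k))\<^sup>2) * card ?S"
      by (rule sum_squared_le_sum_of_squares)
    also have "\<dots> \<le> (\<Sum>k<m. (cmod (y k - x k))\<^sup>2) * real s"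
      using z by (intro mult_mono sum_mono2) (auto simp: sum_nonneg)
    also have "\<dots> = (sqrt (real s) * a)\<^sup>2"
      by (simp add: a_def power_mult_distrib sum_nonneg)
    finally have "(\<Sum>k\<in>?S. cmod (y k - x k)) \<le> sqrt (real s) * a"
      by (rule power2_le_imp_le) (simp add: a_def sum_nonneg)
    then show ?thesis using l1 False unfolding a_def[symmetric] by linarith
  qed
qed

section \<open>Decoupling of the exact program into rows\<close>

lemma frobenius_norm_le_0_iff:
  "frobenius_norm A \<le> 0 \<longleftrightarrow> (\<forall>i<dim_row A. \<forall>j<dim_col A. A $$ (i, j) = 0)"
proof -
  have "frobenius_norm A \<le> 0 \<longleftrightarrow> (\<Sum>i<dim_row A. \<Sum>j<dim_col A. (cmod (A $$ (i, j)))\<^sup>2) = 0"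
    unfolding frobenius_norm_def by (simp add: order_antisym_conv sum_nonneg)
  also have "\<dots> \<longleftrightarrow> (\<forall>i<dim_row A. \<forall>j<dim_col A. A $$ (i, j) = 0)"
    by (simp add: sum_nonneg_eq_0_iff sum_nonneg Ball_def)
  finally show ?thesis .
qed

lemma feasible_iff:
  assumes "\<Phi> \<in> carrier_mat l n" "\<Psi> \<in> carrier_mat m n" "K \<in> carrier_mat l m"
  shows "frobenius_norm (\<Phi> - K * \<Psi>) \<le> 0 \<longleftrightarrow>
    (\<forall>i<l. \<forall>j<n. \<Phi> $$ (i, j) = (\<Sum>k<m. K $$ (i, k) * \<Psi> $$ (k, j)))"
proof -
  have "(K * \<Psi>) $$ (i, j) = (\<Sum>k<m. K $$ (i, k) * \<Psi> $$ (k, j))" if "i < l" "j < n" for i j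
    using that assms by (auto simp: scalar_prod_def atLeast0LessThan intro!: sum.cong)
  then show ?thesis
    using assms by (auto simp: frobenius_norm_le_0_iff)
qed

text \<open>Exchange argument: for zero tolerance the constraint is a separate linear system for
  each row, so row \<open>i\<close> of \<open>Khat\<close> may be replaced by that of
  \<open>K\<close>. The other rows contribute equally to both norms and cancel.\<close>

lemma qcbp_solution_row_l1_le:
  assumes \<Phi>: "\<Phi> \<in> carrier_mat l n" and \<Psi>: "\<Psi> \<in> carrier_mat m n" and K: "K \<in> carrier_mat l m"
    and feas: "frobenius_norm (\<Phi> - K * \<Psi>) \<le> 0"
    and sol: "qcbp_edmd_solution \<Phi> \<Psi> 0 Khat" and i: "i < l"
  shows "(\<Sum>k<m. cmod (Khat $$ (i, k))) \<le> (\<Sum>k<m. cmod (K $$ (i, k)))"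
proof -
  have Khat: "Khat \<in> carrier_mat l m" "frobenius_norm (\<Phi> - Khat * \<Psi>) \<le> 0"
    and min: "\<And>L. L \<in> carrier_mat l m \<Longrightarrow> frobenius_norm (\<Phi> - L * \<Psi>) \<le> 0
      \<Longrightarrow> entrywise_l1_norm Khat \<le> entrywise_l1_norm L"
    using sol \<Phi> \<Psi> by (auto simp: qcbp_edmd_solution_def is_arg_min_def not_less)
  define L where "L = Matrix.mat l m (\<lambda>(i', k). if i' = i then K $$ (i', k) else Khat $$ (i', k))"
  have L: "L \<in> carrier_mat l m" by (simp add: L_def)
  have L_row: "L $$ (i', k) = (if i' = i then K $$ (i', k) else Khat $$ (i', k))" if "i' < l" "k < m" for i' k
    using that by (simp add: L_def)
  have "frobenius_norm (\<Phi> - L * \<Psi>) \<le> 0"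
    unfolding feasible_iff[OF \<Phi> \<Psi> L]
  proof (intro allI impI)
    fix i' j assume ij: "i' < l" "j < n"
    have "(\<Sum>k<m. L $$ (i', k) * \<Psi> $$ (k, j))
        = (if i' = i then \<Sum>k<m. K $$ (i', k) * \<Psi> $$ (k, j) else \<Sum>k<m. Khat $$ (i', k) * \<Psi> $$ (k, j))"
      using ij by (auto simp: L_row intro!: sum.cong)
    then show "\<Phi> $$ (i', j) = (\<Sum>k<m. L $$ (i', k) * \<Psi> $$ (k, j))"
      using ij feas Khat(2) unfolding feasible_iff[OF \<Phi> \<Psi> K] feasible_iff[OF \<Phi> \<Psi> Khat(1)] by simp
  qed
  then have "entrywise_l1_norm Khat \<le> entrywise_l1_norm L" using L by (rule min[rotated])
  then have "(\<Sum>i'<l. \<Sum>k<m. cmod (Khat $$ (i', k))) \<le> (\<Sum>i'<l. \<Sum>k<m. cmod (L $$ (i', k)))"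
    using Khat(1) L by (simp add: entrywise_l1_norm_def)
  moreover have "(\<Sum>i'\<in>{..<l} - {i}. \<Sum>k<m. cmod (L $$ (i', k))) = (\<Sum>i'\<in>{..<l} - {i}. \<Sum>k<m. cmod (Khat $$ (i', k)))"
    by (intro sum.cong) (auto simp: L_row)
  moreover have "(\<Sum>k<m. cmod (L $$ (i, k))) = (\<Sum>k<m. cmod (K $$ (i, k)))"
    using i by (intro sum.cong) (auto simp: L_row)
  ultimately show ?thesis using i by (simp add: sum.remove[of "{..<l}" i])
qed

lemma le_best_term_error:
  assumes "\<And>z. z \<in> carrier_vec (dim_vec c) \<Longrightarrow> vec_l0 z \<le> s \<Longrightarrow> a \<le> vec_l1_norm (c - z)"
  shows "a \<le> best_term_error s c"
proof -
  have "0\<^sub>v (dim_vec c) \<in> {z \<in> carrier_vec (dim_vec c). vec_l0 z \<le> s}"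
  proof -
    have "vec_l0 (0\<^sub>v (dim_vec c)) = 0" by (auto simp: vec_l0_def card_eq_0_iff)
    then show ?thesis by simp
  qed
  then show ?thesis
    unfolding best_term_error_def using assms by (intro cINF_greatest[OF _ assms]) blast+
qed

text \<open>In each row, the difference of the two feasible matrices is a kernel vector, so
  \<open>l1_minimizer_error\<close> applies against every sparse competitor.\<close>

lemma qcbp_solution_error:
  assumes \<Phi>: "\<Phi> \<in> carrier_mat l n" and \<Psi>: "\<Psi> \<in> carrier_mat m n" and K: "K \<in> carrier_mat l m"
    and data: "\<Phi> = K * \<Psi>" and sol: "qcbp_edmd_solution \<Phi> \<Psi> 0 Khat" and s: "s > 0"
    and cone: "\<And>v. \<forall>j<n. (\<Sum>k<m. v k * \<Psi> $$ (k, j)) = 0 \<Longrightarrow>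
      (\<Sum>k<m. cmod (v k)) \<le> 4 * sqrt (real s) * sqrt (\<Sum>k<m. (cmod (v k))\<^sup>2) \<Longrightarrow> \<forall>k<m. v k = 0"
  shows "(frobenius_norm (Khat - K))\<^sup>2 \<le> (\<Sum>i<l. (best_term_error s (col (mat_adjoint K) i))\<^sup>2 / real s)"
proof -
  have Khat: "Khat \<in> carrier_mat l m" and feas': "frobenius_norm (\<Phi> - Khat * \<Psi>) \<le> 0"
    using sol \<Phi> \<Psi> by (auto simp: qcbp_edmd_solution_def is_arg_min_def)
  have feas: "frobenius_norm (\<Phi> - K * \<Psi>) \<le> 0"
    using data K \<Psi> by (simp add: frobenius_norm_le_0_iff)
  have row: "(\<Sum>k<m. (cmod (Khat $$ (i, k) - K $$ (i, k)))\<^sup>2)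
      \<le> (best_term_error s (col (mat_adjoint K) i))\<^sup>2 / real s" if i: "i < l" for i
  proof -
    define a where "a = sqrt (\<Sum>k<m. (cmod (Khat $$ (i, k) - K $$ (i, k)))\<^sup>2)"
    have dim: "dim_vec (col (mat_adjoint K) i) = m" using K by (simp add: mat_adjoint_def)
    have entry: "vec_index (col (mat_adjoint K) i) k = cnj (K $$ (i, k))" if "k < m" for k
      using K i that by (simp add: mat_adjoint_def mat_of_rows_def)
    have ker: "\<forall>j<n. (\<Sum>k<m. (Khat $$ (i, k) - K $$ (i, k)) * \<Psi> $$ (k, j)) = 0"
      using feas feas' i unfolding feasible_iff[OF \<Phi> \<Psi> K] feasible_iff[OF \<Phi> \<Psi> Khat]
      by (simp add: left_diff_distrib sum_subtractf)
    have "sqrt (real s) * a \<le> best_term_error s (col (mat_adjoint K) i)"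
    proof (rule le_best_term_error)
      fix z assume "z \<in> carrier_vec (dim_vec (col (mat_adjoint K) i))" and z0: "vec_l0 z \<le> s"
      then have z: "dim_vec z = m" using dim by simp
      \<comment> \<open>Columns of the adjoint are conjugated rows of \<open>K\<close>, so the
        competitor is conjugated too, which changes neither moduli nor the number of nonzero
        entries.\<close>
      have "sqrt (real s) * a \<le> (\<Sum>k<m. cmod (K $$ (i, k) - cnj (vec_index z k)))"
        unfolding a_def
      proof (rule l1_minimizer_error)
        show "(\<Sum>k<m. cmod (Khat $$ (i, k))) \<le> (\<Sum>k<m. cmod (K $$ (i, k)))"
          using \<Phi> \<Psi> K feas sol i by (rule qcbp_solution_row_l1_le)
        show "card {k. k < m \<and> cnj (vec_index z k) \<noteq> 0} \<le> s" using z0 z by (simp add: vec_l0_def)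
      qed (rule cone[OF ker])
      also have "\<dots> = (\<Sum>k<m. cmod (cnj (K $$ (i, k)) - vec_index z k))"
        by (metis (no_types, lifting) complex_cnj_cnj complex_cnj_diff complex_mod_cnj)
      also have "\<dots> = vec_l1_norm (col (mat_adjoint K) i - z)"
        unfolding vec_l1_norm_def using z dim by (intro sum.cong) (auto simp: entry simp del: index_col)
      finally show "sqrt (real s) * a \<le> vec_l1_norm (col (mat_adjoint K) i - z)" .
    qed
    moreover have "0 \<le> sqrt (real s) * a" by (simp add: a_def sum_nonneg)
    ultimately have "(sqrt (real s) * a)\<^sup>2 \<le> (best_term_error s (col (mat_adjoint K) i))\<^sup>2"
      by (rule power_mono)
    then have "real s * a\<^sup>2 \<le> (best_term_error s (col (mat_adjoint K) i))\<^sup>2"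
      by (simp add: power_mult_distrib)
    then have "a\<^sup>2 \<le> (best_term_error s (col (mat_adjoint K) i))\<^sup>2 / real s"
      using s by (simp add: field_simps)
    then show ?thesis by (simp add: a_def sum_nonneg)
  qed
  have "(frobenius_norm (Khat - K))\<^sup>2 = (\<Sum>i<l. \<Sum>k<m. (cmod (Khat $$ (i, k) - K $$ (i, k)))\<^sup>2)"
    using K Khat by (simp add: frobenius_norm_def sum_nonneg)
  also have "\<dots> \<le> (\<Sum>i<l. (best_term_error s (col (mat_adjoint K) i))\<^sup>2 / real s)"
    using row by (intro sum_mono) auto
  finally show ?thesis .
qed

section \<open>Combining the sample event with deterministic recovery\<close>

lemma log_factor_nonneg:
  assumes B: "1 \<le> B" and "1 \<le> s" "1 \<le> m" and \<epsilon>: "0 < \<epsilon>" "\<epsilon> < 1"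
  shows "0 \<le> log_factor B m \<epsilon> s"
proof -
  have "1 \<le> B\<^sup>2 * real s"
    using assms mult_mono[of 1 "B\<^sup>2" 1 "real s"] by simp
  then have "2 \<le> 2 * B\<^sup>2 * real s" by simp
  then have "ln 2 \<le> ln (2 * B\<^sup>2 * real s)" by (subst ln_le_cancel_iff) linarith+
  then have l: "1/2 \<le> ln (2 * B\<^sup>2 * real s)" using ln2_ge_two_thirds by linarith
  then have "1 \<le> 2 * inverse \<epsilon> * ln (2 * B\<^sup>2 * real s)" using \<epsilon> by (simp add: field_simps)
  then have "0 \<le> ln (2 * inverse \<epsilon> * ln (2 * B\<^sup>2 * real s))" by simp
  moreover have "0 \<le> ln (2 * real m)" using \<open>1 \<le> m\<close> by simp
  ultimately show ?thesis unfolding log_factor_def using l by (intro mult_nonneg_nonneg add_nonneg_nonneg) auto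
qed

theorem theorem4:
  shows "\<exists>C>0. \<exists>C1::real.
    \<forall>(d::nat) (X :: state set) (\<rho> :: state measure) (P :: real \<Rightarrow> state \<Rightarrow> state measure)
      (t::real) (\<tau>::real) (m::nat) (l::nat) (s::nat) (\<epsilon>::real) (\<delta>::real) (B::real)
      (\<psi> :: nat \<Rightarrow> state \<Rightarrow> complex) (\<phi> :: nat \<Rightarrow> state \<Rightarrow> complex) (n::nat)
      (M :: trajectories measure) (K :: complex mat).
      X \<subseteq> space (Pi\<^sub>M {..<d} (\<lambda>_. borel)) \<and>
      prob_space \<rho> \<and> sets \<rho> = sets (state_space d X) \<and>
      0 < \<tau> \<and> P \<tau> \<in> measurable \<rho> (prob_algebra \<rho>) \<and>
      s \<in> {1..m} \<and> 0 < \<epsilon> \<and> \<epsilon> < 1 \<and> 0 < \<delta> \<and> \<delta> \<le> sqrt 2 - 1 \<and>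
      L2_orthonormal \<rho> m \<psi> \<and> (\<forall>j<l. in_L2 \<rho> (\<phi> j)) \<and>
      1 \<le> B \<and> (\<forall>j<m. esssup \<rho> (\<lambda>x. ereal (cmod (\<psi> j x))) \<le> ereal B) \<and>
      real n \<ge> C * inverse (\<delta>\<^sup>2) * B\<^sup>2 * real s * log_factor B m \<epsilon> s \<and>
      prob_space M \<and>
      iid_sample M \<rho> n (\<lambda>i \<omega>. \<omega> i t) \<and>
      (\<forall>i<n. transition_law \<rho> P M (\<lambda>u \<omega>. \<omega> i u) t \<tau>) \<and>
      koopman_matrix \<rho> P \<tau> m \<psi> l \<phi> K \<and>
      (AE \<omega> in M. data_mat l n \<phi> (\<lambda>i. \<omega> i (t + \<tau>)) = K * data_mat m n \<psi> (\<lambda>i. \<omega> i t))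
      \<longrightarrow>
      (\<exists>E \<in> sets M. measure M E > 1 - \<epsilon> \<and>
        (\<forall>\<omega>\<in>E. \<forall>Khat.
          qcbp_edmd_solution (data_mat l n \<phi> (\<lambda>i. \<omega> i (t + \<tau>))) (data_mat m n \<psi> (\<lambda>i. \<omega> i t)) 0 Khat
          \<longrightarrow> (frobenius_norm (Khat - K))\<^sup>2
              \<le> C1 * (\<Sum>i<l. (best_term_error s (col (mat_adjoint K) i))\<^sup>2 / real s)))"
proof (rule exI[of _ "10 ^ 7"], rule conjI, simp, rule exI[of _ 1], intro allI impI, goal_cases)
  \<comment> \<open>The witness \<open>10 ^ 7\<close> for \<open>C\<close> comes from
    \<open>sample_size_parameters\<close>, the witness 1 for \<open>C1\<close> from
    \<open>qcbp_solution_error\<close>.\<close>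
  case (1 d X \<rho> P t \<tau> m l s \<epsilon> \<delta> B \<psi> \<phi> n M K)
  from 1 have \<rho>: "prob_space \<rho>" and s: "1 \<le> s" "s \<le> m" and \<epsilon>: "0 < \<epsilon>" "\<epsilon> < 1"
    and \<delta>: "0 < \<delta>" "\<delta> \<le> sqrt 2 - 1" and ortho: "L2_orthonormal \<rho> m \<psi>" and B: "1 \<le> B"
    and sup: "\<forall>j<m. esssup \<rho> (\<lambda>x. ereal (cmod (\<psi> j x))) \<le> ereal B"
    and n: "real n \<ge> 10 ^ 7 * inverse (\<delta>\<^sup>2) * B\<^sup>2 * real s * log_factor B m \<epsilon> s"
    and M: "prob_space M" and iid: "iid_sample M \<rho> n (\<lambda>i \<omega>. \<omega> i t)"
    and K: "K \<in> carrier_mat l m"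
    and data: "AE \<omega> in M. data_mat l n \<phi> (\<lambda>i. \<omega> i (t + \<tau>)) = K * data_mat m n \<psi> (\<lambda>i. \<omega> i t)"
    by (auto simp: koopman_matrix_def)
  interpret prob_space M by fact
  \<comment> \<open>From \<open>\<delta> \<le> 1\<close> the factor
    \<open>inverse (\<delta>\<^sup>2)\<close> is at least 1, and as the remaining product is
    nonnegative, \<open>n\<close> meets the bound of \<open>sample_size_parameters\<close>.\<close>
  have "sqrt 2 \<le> (2::real)" by (simp add: real_le_lsqrt)
  then have "\<delta>\<^sup>2 \<le> 1" using \<delta> by (intro power_le_one) auto
  then have "1 \<le> inverse (\<delta>\<^sup>2)" using \<delta> by (simp add: one_le_inverse)
  moreover have "0 \<le> 10 ^ 7 * B\<^sup>2 * real s * log_factor B m \<epsilon> s"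
    using log_factor_nonneg[of B s m \<epsilon>] B s \<epsilon> by simp
  ultimately have "1 * (10 ^ 7 * B\<^sup>2 * real s * log_factor B m \<epsilon> s)
      \<le> inverse (\<delta>\<^sup>2) * (10 ^ 7 * B\<^sup>2 * real s * log_factor B m \<epsilon> s)"
    by (rule mult_right_mono)
  then have n': "real n \<ge> 10 ^ 7 * B\<^sup>2 * real s * log_factor B m \<epsilon> s"
    using n by (simp add: mult_ac)
  have bdd: "AE y in \<rho>. \<forall>k<m. cmod (\<psi> k y) \<le> B"
  proof -
    have "AE y in \<rho>. cmod (\<psi> k y) \<le> B" if "k < m" for k
      using esssup_AE[of "\<lambda>x. ereal (cmod (\<psi> k x))" \<rho>]
    proof eventually_elim
      case (elim y)
      then have "ereal (cmod (\<psi> k y)) \<le> ereal B" using sup that by (blast intro: order_trans)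
      then show ?case by simp
    qed
    then have "AE y in \<rho>. \<forall>k\<in>{..<m}. cmod (\<psi> k y) \<le> B" by (intro AE_finite_allI) auto
    then show ?thesis by (rule eventually_mono) auto
  qed
  obtain N ts where params: "n > 0"
    "(8 * sqrt (real s) * B / 2)\<^sup>2 \<le> 2 ^ N / 2" "\<And>i. ts i > 0"
    "\<And>i. i < N \<Longrightarrow> 8 * exp (- (real (ts i) * 2 ^ i / (64 * (8 * sqrt (real s) * B)\<^sup>2))) \<le> 1 / (4 * real N * 2 ^ i)"
    "(\<Sum>i<N. real (4 * m) ^ ts i * exp (- (real n / (8 * real N * 2 ^ i)))) \<le> \<epsilon> / 2"
    using sample_size_parameters[OF B s(1) order_trans[OF s] \<epsilon> n'] by blast
  \<comment> \<open>Failure probability \<open>\<epsilon> / 2\<close> rather than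
    \<open>\<epsilon>\<close> yields the strict inequality of the conclusion.\<close>
  have "\<exists>E\<in>events. prob E \<ge> 1 - \<epsilon> / 2 \<and> (\<forall>\<omega>\<in>E. \<forall>v :: nat \<Rightarrow> complex.
    (\<forall>j<n. (\<Sum>k<m. v k * \<psi> k (\<omega> j t)) = 0) \<longrightarrow>
    (\<Sum>k<m. cmod (v k)) \<le> 8 * sqrt (real s) / 2 * sqrt (\<Sum>k<m. (cmod (v k))\<^sup>2) \<longrightarrow> (\<forall>k<m. v k = 0))"
    by (rule kernel_event[OF \<rho> ortho _ _ _ params(1,3) bdd iid params(2,4,5)]) (use s B in auto)
  then obtain E where E: "E \<in> events" "prob E \<ge> 1 - \<epsilon> / 2"
    and cone: "\<And>\<omega> v. \<omega> \<in> E \<Longrightarrow> \<forall>j<n. (\<Sum>k<m. v k * \<psi> k (\<omega> j t)) = 0 \<Longrightarrow>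
      (\<Sum>k<m. cmod (v k)) \<le> 8 * sqrt (real s) / 2 * sqrt (\<Sum>k<m. (cmod (v k))\<^sup>2) \<Longrightarrow> \<forall>k<m. v k = 0"
    by blast
  \<comment> \<open>The data equation holds only almost surely; removing a measurable null set that
    contains all exceptions makes it available at every remaining sample point.\<close>
  obtain Z where Z: "{\<omega> \<in> space M. data_mat l n \<phi> (\<lambda>i. \<omega> i (t + \<tau>)) \<noteq> K * data_mat m n \<psi> (\<lambda>i. \<omega> i t)} \<subseteq> Z"
    "emeasure M Z = 0" "Z \<in> events"
    using data by (rule AE_E)
  have "prob (E - Z) = prob E"
    using E Z by (intro measure_Diff_null_set) auto
  then have prob: "prob (E - Z) > 1 - \<epsilon>" using E(2) \<epsilon> by simp
  have event: "E - Z \<in> events" using E Z by auto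
  have error: "(frobenius_norm (Khat - K))\<^sup>2
      \<le> 1 * (\<Sum>i<l. (best_term_error s (col (mat_adjoint K) i))\<^sup>2 / real s)"
    if \<omega>: "\<omega> \<in> E - Z" and sol: "qcbp_edmd_solution (data_mat l n \<phi> (\<lambda>i. \<omega> i (t + \<tau>)))
      (data_mat m n \<psi> (\<lambda>i. \<omega> i t)) 0 Khat" for \<omega> Khat
  proof -
    have "\<omega> \<in> space M" using \<omega> E(1) sets.sets_into_space by blast
    then have eq: "data_mat l n \<phi> (\<lambda>i. \<omega> i (t + \<tau>)) = K * data_mat m n \<psi> (\<lambda>i. \<omega> i t)"
      using \<omega> Z(1) by auto
    have trivial: "\<forall>k<m. v k = 0"
      if "\<forall>j<n. (\<Sum>k<m. v k * data_mat m n \<psi> (\<lambda>i. \<omega> i t) $$ (k, j)) = 0"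
        "(\<Sum>k<m. cmod (v k)) \<le> 4 * sqrt (real s) * sqrt (\<Sum>k<m. (cmod (v k))\<^sup>2)" for v
    proof -
      have "\<forall>j<n. (\<Sum>k<m. v k * \<psi> k (\<omega> j t)) = 0" using that(1) by (simp add: data_mat_def)
      then show ?thesis using cone[of \<omega> v] that(2) \<omega> by simp
    qed
    have "(frobenius_norm (Khat - K))\<^sup>2
        \<le> (\<Sum>i<l. (best_term_error s (col (mat_adjoint K) i))\<^sup>2 / real s)"
    proof (rule qcbp_solution_error[where n = n, OF _ _ K eq sol])
      show "data_mat l n \<phi> (\<lambda>i. \<omega> i (t + \<tau>)) \<in> carrier_mat l n"
        "data_mat m n \<psi> (\<lambda>i. \<omega> i t) \<in> carrier_mat m n"
        by (simp_all add: data_mat_def)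
      show "s > 0" using s by simp
    qed (rule trivial)
    then show ?thesis by simp
  qed
  show ?case
  proof (intro bexI[of _ "E - Z"] conjI ballI allI impI)
    show "prob (E - Z) > 1 - \<epsilon>" by (rule prob)
    show "E - Z \<in> events" by (rule event)
  qed (rule error)
qed

end
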